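(* Let $\kappa>0$, $r=1/\kappa$, let $x,y\in\mathbb{R}^2$, and let $d=\|x-y\|$ be the Euclidean distance between $x$ and $y$. Let $|\Sigma(x,y)|$ denote the number of homotopy classes (equivalence classes under $\kappa$-constrained homotopy) in the space $\Sigma(x,y)$ of $\kappa$-constrained plane curves from $x$ to $y$. Then \[ |\Sigma(x,y)|=\begin{cases}1 & \text{if } d=0,\\ 2 & \text{if } 0<d<2r,\\ 1 & \text{if } d\ge 2r.\end{cases}\]
   Context: Fix $\kappa>0$ and put $r=1/\kappa$. A $\kappa$-constrained plane curve is an arc-length parametrised curve $\sigma:[0,s]\to\mathbb{R}^2$ ($s>0$) which is $C^1$ and piecewise $C^2$ and satisfies $\|\sigma''(t)\|\le\kappa$ wherever $\sigma''(t)$ is defined. For $x,y\in\mathbb{R}^2$, $\Sigma(x,y)$ is the set of $\kappa$-constrained plane curves with $\sigma(0)=x$ and $\sigma(s)=y$; the length $s$ and the initial and final tangent vectors are not prescribed. (When $x=y$ no condition relating the initial and final tangent vectors is imposed.) $\Sigma(x,y)$ carries the $C^1$ metric: curves of different lengths are compared after rescaling their arc-length parametrisations linearly to $[0,1]$, using uniform distance of the curves and of their first derivatives. A $\kappa$-constrained homotopy between $\sigma,\gamma\in\Sigma(x,y)$ is a continuous map $H:[0,1]\to\Sigma(x,y)$ with $H(0)=\sigma$ and $H(1)=\gamma$. Two curves are $\kappa$-constrained homotopic if such an $H$ exists; this is an equivalence relation on $\Sigma(x,y)$, and its equivalence classes (the path components) are called homotopy classes. *)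

theory Defs
  imports "HOL-Analysis.Analysis"
begin

text \<open>A curve is a pair \<open>(s, \<sigma>)\<close> of a length and a parametrisation on \<open>{0..s}\<close>.
  Derivatives are taken within \<open>{0..s}\<close>, so they are one-sided at the end points.\<close>

type_synonym plane_curve = "real \<times> (real \<Rightarrow> real^2)"

definition tangent :: "plane_curve \<Rightarrow> real \<Rightarrow> real^2" where
  "tangent c t = vector_derivative (snd c) (at t within {0..fst c})"

definition C1_curve :: "plane_curve \<Rightarrow> bool" where
  "C1_curve c \<longleftrightarrow>
     (\<forall>t\<in>{0..fst c}. snd c differentiable (at t within {0..fst c})) \<and>
     continuous_on {0..fst c} (tangent c)"

definition C2_on_segment :: "(real \<Rightarrow> real^2) \<Rightarrow> real \<Rightarrow> real \<Rightarrow> bool" where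
  "C2_on_segment f a b \<longleftrightarrow>
     (\<exists>f' f''.
        (\<forall>t\<in>{a..b}. (f has_vector_derivative f' t) (at t within {a..b})) \<and>
        (\<forall>t\<in>{a..b}. (f' has_vector_derivative f'' t) (at t within {a..b})) \<and>
        continuous_on {a..b} f'')"

text \<open>Piecewise \<open>C\<^sup>2\<close> in the usual sense: \<open>C\<^sup>2\<close> up to the end points on each closed
  interval of some finite subdivision.\<close>

definition piecewise_C2_curve :: "plane_curve \<Rightarrow> bool" where
  "piecewise_C2_curve c \<longleftrightarrow>
     (\<exists>(n::nat) p. p 0 = 0 \<and> p n = fst c \<and>
        (\<forall>i<n. p i < p (Suc i) \<and> C2_on_segment (snd c) (p i) (p (Suc i))))"

text \<open>The last clause bounds the second derivative at every \<open>t\<close> where it exists,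
  including as a one-sided derivative at \<open>0\<close> and \<open>s\<close>.\<close>

definition constrained_curve :: "real \<Rightarrow> plane_curve \<Rightarrow> bool" where
  "constrained_curve \<kappa> c \<longleftrightarrow>
     0 < fst c \<and>
     C1_curve c \<and>
     piecewise_C2_curve c \<and>
     (\<forall>t\<in>{0..fst c}. norm (tangent c t) = 1) \<and>
     (\<forall>t\<in>{0..fst c}. \<forall>a.
        (tangent c has_vector_derivative a) (at t within {0..fst c}) \<longrightarrow> norm a \<le> \<kappa>)"

text \<open>Requiring extensionality makes the pair \<open>(s, \<sigma>)\<close> determine, and be determined by,
  the curve as a map on \<open>{0..s}\<close>.\<close>

definition constrained_curves :: "real \<Rightarrow> real^2 \<Rightarrow> real^2 \<Rightarrow> plane_curve set" where
  "constrained_curves \<kappa> x y =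
     {(s, \<sigma>). constrained_curve \<kappa> (s, \<sigma>) \<and> \<sigma> \<in> extensional {0..s} \<and> \<sigma> 0 = x \<and> \<sigma> s = y}"

definition rescaled :: "plane_curve \<Rightarrow> real \<Rightarrow> real^2" where
  "rescaled c u = snd c (fst c * u)"

definition rescaled_velocity :: "plane_curve \<Rightarrow> real \<Rightarrow> real^2" where
  "rescaled_velocity c u = vector_derivative (rescaled c) (at u within {0..1})"

text \<open>The absolute value is redundant for \<open>C\<^sup>1\<close> curves, whose suprema are attained. It is there
  because the locale \<^locale>\<open>Metric_space\<close> demands nonnegativity for all arguments, and suprema
  of unbounded sets of reals are unspecified.\<close>

definition C1_dist :: "plane_curve \<Rightarrow> plane_curve \<Rightarrow> real" where
  "C1_dist c c' =
     \<bar>(SUP u\<in>{0..1}. dist (rescaled c u) (rescaled c' u)) +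
      (SUP u\<in>{0..1}. dist (rescaled_velocity c u) (rescaled_velocity c' u))\<bar>"

definition curve_topology :: "real \<Rightarrow> real^2 \<Rightarrow> real^2 \<Rightarrow> plane_curve topology" where
  "curve_topology \<kappa> x y = Metric_space.mtopology (constrained_curves \<kappa> x y) C1_dist"

definition constrained_homotopy ::
    "real \<Rightarrow> real^2 \<Rightarrow> real^2 \<Rightarrow> (real \<Rightarrow> plane_curve) \<Rightarrow> plane_curve \<Rightarrow> plane_curve \<Rightarrow> bool" where
  "constrained_homotopy \<kappa> x y H c c' \<longleftrightarrow>
     continuous_map (top_of_set {0..1}) (curve_topology \<kappa> x y) H \<and> H 0 = c \<and> H 1 = c'"

definition constrained_homotopic :: "real \<Rightarrow> real^2 \<Rightarrow> real^2 \<Rightarrow> (plane_curve \<times> plane_curve) set" where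
  "constrained_homotopic \<kappa> x y =
     {(c, c'). c \<in> constrained_curves \<kappa> x y \<and> c' \<in> constrained_curves \<kappa> x y \<and>
        (\<exists>H. constrained_homotopy \<kappa> x y H c c')}"

definition homotopy_classes :: "real \<Rightarrow> real^2 \<Rightarrow> real^2 \<Rightarrow> plane_curve set set" where
  "homotopy_classes \<kappa> x y = constrained_curves \<kappa> x y // constrained_homotopic \<kappa> x y"

text \<open>\<^const>\<open>C1_dist\<close> is a metric, so \<^const>\<open>curve_topology\<close> is the metric topology.\<close>

lemma rescaled_has_velocity:
  assumes "C1_curve c" "0 < fst c" "u \<in> {0..1}"
  shows "(rescaled c has_vector_derivative fst c *\<^sub>R tangent c (fst c * u)) (at u within {0..1})"
proof -
  have img: "(*) (fst c) ` {0..1} = {0..fst c}"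
    using assms(2) image_mult_atLeastAtMost[of "fst c" 0 1] by simp
  have "fst c * u \<in> {0..fst c}" using imageI[OF assms(3), of "(*) (fst c)"] unfolding img .
  then have "(snd c has_vector_derivative tangent c (fst c * u))
      (at (fst c * u) within (*) (fst c) ` {0..1})"
    using assms(1) unfolding C1_curve_def tangent_def img
    by (simp add: vector_derivative_works)
  moreover have "((*) (fst c) has_vector_derivative fst c) (at u within {0..1})"
    by (auto intro!: derivative_eq_intros)
  ultimately have "(snd c \<circ> (*) (fst c) has_vector_derivative fst c *\<^sub>R tangent c (fst c * u))
      (at u within {0..1})"
    by (rule vector_diff_chain_within[rotated])
  moreover have "snd c \<circ> (*) (fst c) = rescaled c"
    by (simp add: rescaled_def fun_eq_iff)
  ultimately show ?thesis by simp
qed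

lemma rescaled_velocity_eq:
  assumes "C1_curve c" "0 < fst c" "u \<in> {0..1}"
  shows "rescaled_velocity c u = fst c *\<^sub>R tangent c (fst c * u)"
  unfolding rescaled_velocity_def
  using vector_derivative_within_cbox[of 0 1 u "rescaled c"] rescaled_has_velocity[OF assms] assms(3)
  by simp

lemma continuous_on_rescaled:
  assumes "C1_curve c" "0 < fst c"
  shows "continuous_on {0..1} (rescaled c)"
  using rescaled_has_velocity[OF assms] has_vector_derivative_continuous
  unfolding continuous_on_eq_continuous_within by blast

lemma continuous_on_rescaled_velocity:
  assumes "C1_curve c" "0 < fst c"
  shows "continuous_on {0..1} (rescaled_velocity c)"
proof -
  have "continuous_on {0..fst c} (tangent c)"
    using assms unfolding C1_curve_def by blast
  then have "continuous_on {0..1} (\<lambda>u. tangent c (fst c * u))"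
  proof (rule continuous_on_compose2)
    show "continuous_on {0..1} (\<lambda>u. fst c * u)"
      by (intro continuous_on_mult continuous_on_const continuous_on_id)
    show "(\<lambda>u. fst c * u) ` {0..1} \<subseteq> {0..fst c}"
      using image_mult_atLeastAtMost[OF assms(2), of 0 1] by simp
  qed
  then have "continuous_on {0..1} (\<lambda>u. fst c *\<^sub>R tangent c (fst c * u))"
    by (rule continuous_on_scaleR[OF continuous_on_const])
  then show ?thesis
    by (rule continuous_on_eq) (rule rescaled_velocity_eq[OF assms, symmetric])
qed

lemma sup_dist_upper:
  fixes f g :: "real \<Rightarrow> real^2"
  assumes "continuous_on {0..1} f" "continuous_on {0..1} g" "u \<in> {0..1}"
  shows "dist (f u) (g u) \<le> (SUP u\<in>{0..1}. dist (f u) (g u))"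
proof -
  have "compact ((\<lambda>u. dist (f u) (g u)) ` {0..1})"
    by (rule compact_continuous_image[OF continuous_on_dist[OF assms(1,2)] compact_Icc])
  then show ?thesis
    by (rule cSUP_upper[OF assms(3) bounded_imp_bdd_above[OF compact_imp_bounded]])
qed

lemma sup_dist_triangle:
  fixes f g h :: "real \<Rightarrow> real^2"
  assumes "continuous_on {0..1} f" "continuous_on {0..1} g" "continuous_on {0..1} h"
  shows "(SUP u\<in>{0..1}. dist (f u) (h u)) \<le>
    (SUP u\<in>{0..1}. dist (f u) (g u)) + (SUP u\<in>{0..1}. dist (g u) (h u))"
proof (rule cSUP_least)
  fix u :: real assume u: "u \<in> {0..1}"
  show "dist (f u) (h u) \<le> (SUP u\<in>{0..1}. dist (f u) (g u)) + (SUP u\<in>{0..1}. dist (g u) (h u))"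
    using sup_dist_upper[OF assms(1,2) u] sup_dist_upper[OF assms(2,3) u]
      dist_triangle[of "f u" "h u" "g u"] by linarith
qed simp

lemma Metric_space_constrained_curves:
  "Metric_space (constrained_curves \<kappa> x y) C1_dist"
proof -
  let ?M = "constrained_curves \<kappa> x y"
  have C: "C1_curve c" "0 < fst c" if "c \<in> ?M" for c
    using that by (auto simp: constrained_curves_def constrained_curve_def)
  note cont = continuous_on_rescaled[OF C] continuous_on_rescaled_velocity[OF C]
  have sup_nonneg: "0 \<le> (SUP u\<in>{0..1}. dist (f u) (g u))"
    if "continuous_on {0..1} f" "continuous_on {0..1} g" for f g :: "real \<Rightarrow> real^2"
    using order_trans[OF zero_le_dist sup_dist_upper[OF that, of 0]] by simp
  have val: "C1_dist c c' = (SUP u\<in>{0..1}. dist (rescaled c u) (rescaled c' u)) +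
      (SUP u\<in>{0..1}. dist (rescaled_velocity c u) (rescaled_velocity c' u))"
    if "c \<in> ?M" "c' \<in> ?M" for c c'
    unfolding C1_dist_def
    by (rule abs_of_nonneg[OF add_nonneg_nonneg[OF
        sup_nonneg[OF cont(1)[OF that(1) that(1)] cont(1)[OF that(2) that(2)]]
        sup_nonneg[OF cont(2)[OF that(1) that(1)] cont(2)[OF that(2) that(2)]]]])
  have eq: "c = c'" if M: "c \<in> ?M" "c' \<in> ?M" and 0: "C1_dist c c' = 0" for c c'
  proof -
    note c1 = cont(1)[OF M(1) M(1)] cont(1)[OF M(2) M(2)] and c2 = cont(2)[OF M(1) M(1)] cont(2)[OF M(2) M(2)]
    have s: "(SUP u\<in>{0..1}. dist (rescaled c u) (rescaled c' u)) = 0"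
         "(SUP u\<in>{0..1}. dist (rescaled_velocity c u) (rescaled_velocity c' u)) = 0"
      using 0 sup_nonneg[OF c1] sup_nonneg[OF c2] unfolding val[OF M] by linarith+
    have r: "rescaled c u = rescaled c' u" "rescaled_velocity c u = rescaled_velocity c' u"
      if "u \<in> {0..1}" for u
      using sup_dist_upper[OF c1 that] sup_dist_upper[OF c2 that] s by auto
    have len: "fst c = norm (rescaled_velocity c 0)" if "c \<in> ?M" for c
      using rescaled_velocity_eq[OF C[OF that], of 0] that C[OF that]
      by (auto simp: constrained_curves_def constrained_curve_def)
    have l: "fst c = fst c'" using len[OF M(1)] len[OF M(2)] r(2)[of 0] by simp
    have "snd c t = snd c' t" if "t \<in> {0..fst c}" for t
      using r(1)[of "t / fst c"] that C(2)[OF M(1)] l by (auto simp: rescaled_def)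
    moreover have "snd c \<in> extensional {0..fst c}" "snd c' \<in> extensional {0..fst c}"
      using M l by (auto simp: constrained_curves_def)
    ultimately have "snd c = snd c'" by (blast intro: extensionalityI)
    then show ?thesis using l by (simp add: prod_eq_iff)
  qed
  show ?thesis
  proof
    show "0 \<le> C1_dist c c'" for c c'
      by (simp add: C1_dist_def)
    show "C1_dist c c' = C1_dist c' c" for c c'
      by (simp add: C1_dist_def dist_commute)
    show "C1_dist c c' = 0 \<longleftrightarrow> c = c'" if "c \<in> ?M" "c' \<in> ?M" for c c'
      using eq[OF that] by (auto simp: C1_dist_def)
    show "C1_dist c c'' \<le> C1_dist c c' + C1_dist c' c''"
      if M: "c \<in> ?M" "c' \<in> ?M" "c'' \<in> ?M" for c c' c''
    proof -
      note p = cont(1)[OF M(1) M(1)] cont(1)[OF M(2) M(2)] cont(1)[OF M(3) M(3)]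
      note v = cont(2)[OF M(1) M(1)] cont(2)[OF M(2) M(2)] cont(2)[OF M(3) M(3)]
      show ?thesis
        using sup_dist_triangle[OF p] sup_dist_triangle[OF v]
        unfolding val[OF M(1,2)] val[OF M(2,3)] val[OF M(1,3)] by linarith
    qed
  qed
qed

lemma topspace_curve_topology: "topspace (curve_topology \<kappa> x y) = constrained_curves \<kappa> x y"
  unfolding curve_topology_def
  by (rule Metric_space.topspace_mtopology[OF Metric_space_constrained_curves])

lemma constrained_homotopic_iff:
  "(c, c') \<in> constrained_homotopic \<kappa> x y \<longleftrightarrow> path_component_of (curve_topology \<kappa> x y) c c'"
proof -
  have "(c, c') \<in> constrained_homotopic \<kappa> x y \<longleftrightarrow>
      c \<in> constrained_curves \<kappa> x y \<and> c' \<in> constrained_curves \<kappa> x y \<and>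
      path_component_of (curve_topology \<kappa> x y) c c'"
    unfolding constrained_homotopic_def constrained_homotopy_def path_component_of_def pathin_def
    by simp
  then show ?thesis
    using path_component_in_topspace[of "curve_topology \<kappa> x y" c c']
    unfolding topspace_curve_topology by blast
qed

lemma equiv_constrained_homotopic:
  "equiv (constrained_curves \<kappa> x y) (constrained_homotopic \<kappa> x y)"
proof (rule equivI)
  show "constrained_homotopic \<kappa> x y \<subseteq> constrained_curves \<kappa> x y \<times> constrained_curves \<kappa> x y"
    unfolding constrained_homotopic_def by blast
  show "refl_on (constrained_curves \<kappa> x y) (constrained_homotopic \<kappa> x y)"
    unfolding refl_on_def constrained_homotopic_iff path_component_of_refl
      topspace_curve_topology by simp
  show "sym (constrained_homotopic \<kappa> x y)"
    by (rule symI) (unfold constrained_homotopic_iff, rule path_component_of_sym)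
  show "trans (constrained_homotopic \<kappa> x y)"
    by (rule transI) (unfold constrained_homotopic_iff, rule path_component_of_trans)
qed

end

theory Submission
  imports Defs
begin

text \<open>A constrained curve is given by its length and a \<open>\<kappa>\<close>-Lipschitz angle function, so a homotopy
  amounts to a continuous family of angle functions whose displacement stays \<open>y - x\<close>. If the angle
  ranges over more than \<open>\<pi>\<close>, three of the tangent directions span the plane positively, and straight
  segments inserted there absorb any change of the displacement; this connects all such \<open>wide\<close>
  curves to each other. If the range is at most \<open>\<pi>\<close> and the length at least \<open>\<pi> r\<close>, then
  \<open>d \<ge> 2 r\<close>. Hence for \<open>0 < d < 2 r\<close> no curve has length \<open>\<pi> r\<close>: the longer curves are wide, while
  the shorter ones retract to the line segment, as their displacement can only shrink when they are
  consumed from the start, which one straight segment and a rotation compensate. For \<open>d = 0\<close> every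
  curve is wide. For \<open>d \<ge> 2 r\<close> every curve can be deformed until its initial tangent is orthogonal
  to the displacement; prepending an arc of radius \<open>r\<close> then makes it wide without the
  displacement ever exceeding \<open>d\<close>.\<close>

text \<open>The curvature bound may be attained along a whole curve, so an error in the displacement
  cannot be corrected by bending. A straight segment never violates the bound, but it can only be
  inserted with nonnegative length and in a direction that the curve already takes. Errors of every
  direction can therefore be absorbed once the tangents span the plane positively, which an angle
  range above \<open>pi\<close> guarantees. For other curves a single segment together with a
  rotation must do; this works as long as the norm of the uncorrected displacement never exceeds
  \<open>d\<close>, so each deformation of such a curve is arranged to respect that bound. Curves
  are shown not to be homotopic by their lengths alone: the length is continuous in the
  \<open>C^1\<close> metric, so a homotopy cannot jump over a length that no curve has. The
  thresholds come from one extremal curve, the semicircle of radius \<open>r\<close>, with length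
  \<open>pi r\<close>, angle range \<open>pi\<close> and displacement \<open>2 r\<close>.\<close>

section \<open>The plane as the complex numbers, with unit tangents as values of
  \<open>cis\<close>\<close>

definition pt :: "complex \<Rightarrow> real^2" where "pt z = vector [Re z, Im z]"

definition cx :: "real^2 \<Rightarrow> complex" where "cx v = Complex (v$1) (v$2)"

lemma pt_cx [simp]: "pt (cx v) = v"
  by (simp add: pt_def cx_def vec_eq_iff forall_2)

lemma norm_pt [simp]: "norm (pt z) = norm z"
  by (simp add: pt_def norm_vec_def L2_set_def sum_2 cmod_def)

lemma norm_cx [simp]: "norm (cx v) = norm v"
  by (metis norm_pt pt_cx)

lemma linear_pt: "linear pt"
  by (rule linearI) (simp_all add: pt_def vec_eq_iff forall_2)

lemma linear_cx: "linear cx"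
  by (rule linearI) (simp_all add: cx_def complex_eq_iff)

lemma bounded_linear_pt: "bounded_linear pt"
  using linear_pt linear_conv_bounded_linear by blast

lemma bounded_linear_cx: "bounded_linear cx"
  using linear_cx linear_conv_bounded_linear by blast

lemmas pt_diff = linear_diff[OF linear_pt]
lemmas cx_diff = linear_diff[OF linear_cx]

lemma pt_0 [simp]: "pt 0 = 0"
  using linear_0[OF linear_pt] .

lemma dist_cis_le: "norm (cis a - cis b) \<le> \<bar>a - b\<bar>"
proof -
  have d: "(cis has_derivative (\<lambda>h. h *\<^sub>R (\<i> * cis x))) (at x within UNIV)" for x
    using has_derivative_cis[OF has_derivative_ident, of x UNIV] by simp
  have "onorm (\<lambda>h::real. h *\<^sub>R (\<i> * cis x)) \<le> 1" for x
    by (rule onorm_le) (simp add: norm_mult)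
  then have "norm (cis a - cis b) \<le> 1 * norm (a - b)"
    by (intro differentiable_bound[OF convex_UNIV d]) auto
  then show ?thesis by simp
qed

section \<open>Piecewise smooth Lipschitz angle functions\<close>

definition C1_on :: "(real \<Rightarrow> real) \<Rightarrow> real \<Rightarrow> real \<Rightarrow> bool" where
  "C1_on f a b \<longleftrightarrow> (\<exists>f'. (\<forall>t\<in>{a..b}. (f has_vector_derivative f' t) (at t within {a..b})) \<and>
     continuous_on {a..b} f')"

lemma C1_on_cong:
  assumes "\<And>t. t \<in> {a..b} \<Longrightarrow> f t = g t" "C1_on f a b"
  shows "C1_on g a b"
proof -
  obtain f' where f': "\<And>t. t \<in> {a..b} \<Longrightarrow> (f has_vector_derivative f' t) (at t within {a..b})"
    "continuous_on {a..b} f'"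
    using assms(2) unfolding C1_on_def by blast
  have "(g has_vector_derivative f' t) (at t within {a..b})" if "t \<in> {a..b}" for t
    by (rule has_vector_derivative_transform[OF that _ f'(1)[OF that]]) (simp add: assms(1))
  then show ?thesis unfolding C1_on_def using f'(2) by blast
qed

lemma C1_on_shift:
  assumes "C1_on f (a + c) (b + c)"
  shows "C1_on (\<lambda>t. w + f (t + c)) a b"
proof -
  obtain f' where f': "\<And>t. t \<in> {a+c..b+c} \<Longrightarrow> (f has_vector_derivative f' t) (at t within {a+c..b+c})"
    "continuous_on {a+c..b+c} f'"
    using assms unfolding C1_on_def by blast
  have im: "(\<lambda>t. t + c) ` {a..b} = {a+c..b+c}" by simp
  have "((\<lambda>t. w + f (t + c)) has_vector_derivative f' (t + c)) (at t within {a..b})" if "t \<in> {a..b}" for t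
  proof -
    have 1: "((\<lambda>t. t + c) has_vector_derivative 1) (at t within {a..b})"
      by (auto intro!: derivative_eq_intros)
    have 2: "(f has_vector_derivative f' (t + c)) (at (t + c) within (\<lambda>t. t + c) ` {a..b})"
      unfolding im using f'(1)[of "t + c"] that by simp
    have "(f \<circ> (\<lambda>t. t + c) has_vector_derivative 1 *\<^sub>R f' (t + c)) (at t within {a..b})"
      by (rule vector_diff_chain_within[OF 1 2])
    then show ?thesis
      using has_vector_derivative_add[OF has_vector_derivative_const[of w]] by (fastforce simp: o_def)
  qed
  moreover have "continuous_on {a..b} (\<lambda>t. f' (t + c))"
    by (rule continuous_on_compose2[OF f'(2)]) (auto intro!: continuous_intros)
  ultimately show ?thesis unfolding C1_on_def by (intro exI[of _ "\<lambda>t. f' (t + c)"]) auto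
qed

lemma C1_on_affine: "C1_on (\<lambda>t. c + m * t) a b"
  unfolding C1_on_def
  by (intro exI[of _ "\<lambda>_. m"]) (auto intro!: derivative_eq_intros)

text \<open>Asking for smoothness on every interval whose interior avoids a finite set replaces
  ordered subdivisions: gluing takes the union of the exceptional sets and shifting translates them.
  Only the open interval has to avoid \<open>S\<close>, so one-sided derivatives exist up to the
  breakpoints.\<close>

definition pw_C1 :: "(real \<Rightarrow> real) \<Rightarrow> bool" where
  "pw_C1 f \<longleftrightarrow> (\<exists>S. finite S \<and> (\<forall>a b. a < b \<longrightarrow> {a<..<b} \<inter> S = {} \<longrightarrow> C1_on f a b))"

lemma pw_C1_glue:
  assumes "pw_C1 f" "pw_C1 g" "f p = g p"
  shows "pw_C1 (\<lambda>t. if t \<le> p then f t else g t)"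
proof -
  obtain S where S: "finite S" "\<And>a b. a < b \<Longrightarrow> {a<..<b} \<inter> S = {} \<Longrightarrow> C1_on f a b"
    using assms(1) unfolding pw_C1_def by blast
  obtain T where T: "finite T" "\<And>a b. a < b \<Longrightarrow> {a<..<b} \<inter> T = {} \<Longrightarrow> C1_on g a b"
    using assms(2) unfolding pw_C1_def by blast
  have "C1_on (\<lambda>t. if t \<le> p then f t else g t) a b"
    if "a < b" and d: "{a<..<b} \<inter> insert p (S \<union> T) = {}" for a b
  proof (cases "b \<le> p")
    case True
    have "C1_on f a b" using S(2)[OF \<open>a < b\<close>] d by blast
    then show ?thesis by (rule C1_on_cong[rotated]) (use True in auto)
  next
    case False
    then have "p \<le> a" using d by force
    have "C1_on g a b" using T(2)[OF \<open>a < b\<close>] d by blast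
    moreover have "g t = (if t \<le> p then f t else g t)" if "t \<in> {a..b}" for t
      using that \<open>p \<le> a\<close> assms(3) by (cases "t = p") auto
    ultimately show ?thesis by (rule C1_on_cong[rotated])
  qed
  then show ?thesis unfolding pw_C1_def using S(1) T(1)
    by (intro exI[of _ "insert p (S \<union> T)"]) auto
qed

lemma pw_C1_shift:
  assumes "pw_C1 f"
  shows "pw_C1 (\<lambda>t. w + f (t + c))"
proof -
  obtain S where S: "finite S" "\<And>a b. a < b \<Longrightarrow> {a<..<b} \<inter> S = {} \<Longrightarrow> C1_on f a b"
    using assms(1) unfolding pw_C1_def by blast
  have "C1_on (\<lambda>t. w + f (t + c)) a b"
    if "a < b" and d: "{a<..<b} \<inter> (\<lambda>t. t - c) ` S = {}" for a b
  proof (rule C1_on_shift, rule S(2))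
    show "{a + c<..<b + c} \<inter> S = {}"
    proof (rule ccontr)
      assume "{a + c<..<b + c} \<inter> S \<noteq> {}"
      then obtain t where "t \<in> S" "a + c < t" "t < b + c" by auto
      then have "t - c \<in> {a<..<b} \<inter> (\<lambda>t. t - c) ` S" by auto
      then show False using d by blast
    qed
  qed (use that in simp)
  then show ?thesis unfolding pw_C1_def using S(1)
    by (intro exI[of _ "(\<lambda>t. t - c) ` S"]) auto
qed

lemma pw_C1_affine: "pw_C1 (\<lambda>t. c + m * t)"
  unfolding pw_C1_def by (intro exI[of _ "{}"]) (auto simp: C1_on_affine)

text \<open>The functions live on the whole line although a curve uses only \<open>{0..L}\<close>,
  so shifts, pauses and prepended arcs stay within the class. The Lipschitz bound is the integrated
  curvature bound and survives gluing at corners.\<close>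

definition angular :: "real \<Rightarrow> (real \<Rightarrow> real) \<Rightarrow> bool" where
  "angular \<kappa> f \<longleftrightarrow> \<kappa>-lipschitz_on UNIV f \<and> pw_C1 f"

lemma angularD: "angular \<kappa> f \<Longrightarrow> \<bar>f s - f t\<bar> \<le> \<kappa> * \<bar>s - t\<bar>"
  unfolding angular_def using lipschitz_onD[of \<kappa> UNIV f s t] by (simp add: dist_real_def)

lemma angular_continuous: "angular \<kappa> f \<Longrightarrow> continuous_on A f"
  unfolding angular_def using lipschitz_on_continuous_on continuous_on_subset by blast

lemma angular_nonneg: "angular \<kappa> f \<Longrightarrow> 0 \<le> \<kappa>"
  unfolding angular_def using lipschitz_on_nonneg by blast

lemma lipschitz_on_UNIV_glue:
  fixes f g :: "real \<Rightarrow> real"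
  assumes "\<kappa>-lipschitz_on {..p} f" "\<kappa>-lipschitz_on {p..} g" "f p = g p"
  shows "\<kappa>-lipschitz_on UNIV (\<lambda>t. if t \<le> p then f t else g t)"
proof (rule lipschitz_onI)
  fix s t :: real
  let ?h = "\<lambda>t. if t \<le> p then f t else g t"
  have "\<kappa>-lipschitz_on {min s (min t p)..max s (max t p)} ?h"
    by (rule lipschitz_on_concat[OF lipschitz_on_subset[OF assms(1)] lipschitz_on_subset[OF assms(2)] assms(3)]) auto
  then show "dist (?h s) (?h t) \<le> \<kappa> * dist s t"
    by (rule lipschitz_onD) auto
qed (use assms lipschitz_on_nonneg in blast)

lemma angular_glue:
  assumes "angular \<kappa> f" "angular \<kappa> g" "f p = g p"
  shows "angular \<kappa> (\<lambda>t. if t \<le> p then f t else g t)"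
  unfolding angular_def
proof
  have "\<kappa>-lipschitz_on {..p} f" "\<kappa>-lipschitz_on {p..} g"
    using assms lipschitz_on_subset[OF _ subset_UNIV] unfolding angular_def by blast+
  then show "\<kappa>-lipschitz_on UNIV (\<lambda>t. if t \<le> p then f t else g t)"
    using assms(3) by (rule lipschitz_on_UNIV_glue)
  show "pw_C1 (\<lambda>t. if t \<le> p then f t else g t)"
    using assms pw_C1_glue unfolding angular_def by blast
qed

lemma angular_shift:
  assumes "angular \<kappa> f"
  shows "angular \<kappa> (\<lambda>t. w + f (t + c))"
  unfolding angular_def
proof
  show "\<kappa>-lipschitz_on UNIV (\<lambda>t. w + f (t + c))"
  proof (rule lipschitz_onI)
    show "dist (w + f (s + c)) (w + f (t + c)) \<le> \<kappa> * dist s t" for s t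
      using angularD[OF assms, of "s + c" "t + c"] by (simp add: dist_real_def)
  qed (rule angular_nonneg[OF assms])
  show "pw_C1 (\<lambda>t. w + f (t + c))" using assms pw_C1_shift unfolding angular_def by blast
qed

lemma angular_affine:
  assumes "\<bar>m\<bar> \<le> \<kappa>"
  shows "angular \<kappa> (\<lambda>t. c + m * t)"
  unfolding angular_def
proof
  show "\<kappa>-lipschitz_on UNIV (\<lambda>t. c + m * t)"
  proof (rule lipschitz_onI)
    show "dist (c + m * s) (c + m * t) \<le> \<kappa> * dist s t" for s t
    proof -
      have "dist (c + m * s) (c + m * t) = \<bar>m\<bar> * \<bar>s - t\<bar>"
        by (simp add: dist_real_def abs_mult[symmetric] algebra_simps)
      also have "\<dots> \<le> \<kappa> * \<bar>s - t\<bar>" using assms by (rule mult_right_mono) simp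
      finally show ?thesis by (simp add: dist_real_def)
    qed
  qed (use assms in simp)
qed (rule pw_C1_affine)

text \<open>Composing with \<open>stall p s\<close> pauses a curve's turning at parameter \<open>p\<close>, which
  inserts a straight segment of length \<open>s\<close> there.\<close>

definition stall :: "real \<Rightarrow> real \<Rightarrow> real \<Rightarrow> real" where
  "stall p s t = min t p + max 0 (t - p - s)"

lemma stall_0 [simp]: "stall p 0 t = t"
  by (simp add: stall_def)

lemma stall_below: "0 \<le> s \<Longrightarrow> t \<le> p \<Longrightarrow> stall p s t = t"
  by (simp add: stall_def)

lemma stall_above: "0 \<le> s \<Longrightarrow> p + s \<le> t \<Longrightarrow> stall p s t = t - s"
  by (simp add: stall_def)

lemma stall_between: "0 \<le> s \<Longrightarrow> p \<le> t \<Longrightarrow> t \<le> p + s \<Longrightarrow> stall p s t = p"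
  by (simp add: stall_def)

lemma angular_stall:
  assumes "angular \<kappa> f" "0 \<le> s"
  shows "angular \<kappa> (\<lambda>t. f (stall p s t))"
proof -
  have k: "angular \<kappa> (\<lambda>t. f p)"
    using angular_affine[of 0 \<kappa> "f p"] angular_nonneg[OF assms(1)] by simp
  have sh: "angular \<kappa> (\<lambda>t. f (t - s))"
    using angular_shift[OF assms(1), of 0 "-s"] by simp
  have 1: "angular \<kappa> (\<lambda>t. if t \<le> p + s then f p else f (t - s))"
    by (rule angular_glue[OF k sh]) simp
  have "angular \<kappa> (\<lambda>t. if t \<le> p then f t else if t \<le> p + s then f p else f (t - s))"
    by (rule angular_glue[OF assms(1) 1]) (use assms(2) in simp)
  also have "(\<lambda>t. if t \<le> p then f t else if t \<le> p + s then f p else f (t - s)) = (\<lambda>t. f (stall p s t))"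
    using assms(2) by (auto simp: fun_eq_iff stall_below stall_above stall_between)
  finally show ?thesis .
qed

section \<open>Displacement as the integral of the unit tangent\<close>

text \<open>This is the oriented integral from \<open>0\<close>: one of the two terms always
  vanishes. Negative parameters do occur, when something is prepended to a curve.\<close>

definition primitive :: "(real \<Rightarrow> real) \<Rightarrow> real \<Rightarrow> complex" where
  "primitive f t = integral {0..t} (\<lambda>u. cis (f u)) - integral {t..0} (\<lambda>u. cis (f u))"

definition disp :: "(real \<Rightarrow> real) \<Rightarrow> real \<Rightarrow> real \<Rightarrow> complex" where
  "disp f a b = primitive f b - primitive f a"

lemma disp_self [simp]: "disp f a a = 0"
  by (simp add: disp_def)

lemma disp_add: "disp f a b + disp f b c = disp f a c"
  by (simp add: disp_def)

lemma primitive_deriv: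
  assumes f: "continuous_on UNIV f"
  shows "(primitive f has_vector_derivative cis (f t)) (at t within A)"
proof -
  \<comment> \<open>On \<open>{-N..N}\<close> both signs of the argument reduce to an integral from
    the common base point \<open>-N\<close>, to which the fundamental theorem applies.\<close>
  define N where "N = \<bar>t\<bar> + 1"
  have N: "-N < t" "t < N" "0 < N" unfolding N_def by linarith+
  have c: "continuous_on B (\<lambda>u. cis (f u))" for B
    using continuous_on_subset[OF f] by (intro continuous_intros) auto
  have i: "(\<lambda>u. cis (f u)) integrable_on {a..b}" for a b
    by (rule integrable_continuous_real[OF c])
  have "((\<lambda>u. integral {-N..u} (\<lambda>u. cis (f u)) - integral {-N..0} (\<lambda>u. cis (f u)))
      has_vector_derivative cis (f t) - 0) (at t within {-N..N})"
    by (intro has_vector_derivative_diff has_vector_derivative_const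
        integral_has_vector_derivative[OF c]) (use N in auto)
  then have "((\<lambda>u. integral {-N..u} (\<lambda>u. cis (f u)) - integral {-N..0} (\<lambda>u. cis (f u)))
      has_vector_derivative cis (f t)) (at t)"
    using at_within_interior[of t "{-N..N}"] N by simp
  then have "(primitive f has_vector_derivative cis (f t)) (at t)"
  proof (rule has_vector_derivative_transform_within_open)
    show "open {-N<..<N}" "t \<in> {-N<..<N}" using N by auto
    show "integral {-N..u} (\<lambda>u. cis (f u)) - integral {-N..0} (\<lambda>u. cis (f u)) = primitive f u"
      if "u \<in> {-N<..<N}" for u
    proof (cases "0 \<le> u")
      case True
      then show ?thesis
        using Henstock_Kurzweil_Integration.integral_combine[of "-N" 0 u "\<lambda>u. cis (f u)"] N i that
        by (cases "u = 0") (auto simp: primitive_def algebra_simps)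
    next
      case False
      then show ?thesis
        using Henstock_Kurzweil_Integration.integral_combine[of "-N" u 0 "\<lambda>u. cis (f u)"] N i that
        by (auto simp: primitive_def algebra_simps)
    qed
  qed
  then show ?thesis by (rule has_vector_derivative_at_within)
qed

lemma continuous_on_primitive:
  assumes "continuous_on UNIV f" shows "continuous_on A (primitive f)"
  using primitive_deriv[OF assms] has_vector_derivative_continuous
  unfolding continuous_on_eq_continuous_within by blast

lemma has_integral_disp:
  assumes "continuous_on UNIV f" "a \<le> b"
  shows "((\<lambda>t. cis (f t)) has_integral disp f a b) {a..b}"
  unfolding disp_def
  by (rule fundamental_theorem_of_calculus[OF assms(2)]) (rule primitive_deriv[OF assms(1)])

lemma disp_eqI:
  assumes "continuous_on UNIV f" "a \<le> b"
    and "\<And>t. t \<in> {a..b} \<Longrightarrow> (G has_vector_derivative cis (f t)) (at t within {a..b})"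
  shows "disp f a b = G b - G a"
proof -
  have "((\<lambda>t. cis (f t)) has_integral G b - G a) {a..b}"
    by (rule fundamental_theorem_of_calculus[OF assms(2)]) (rule assms(3))
  then show ?thesis using has_integral_disp[OF assms(1,2)] has_integral_unique by blast
qed

lemma disp_cong:
  assumes "continuous_on UNIV f" "continuous_on UNIV g" "a \<le> b"
    and "\<And>t. t \<in> {a..b} \<Longrightarrow> f t = g t"
  shows "disp f a b = disp g a b"
  unfolding disp_def[of g]
  by (rule disp_eqI[OF assms(1,3)]) (use primitive_deriv[OF assms(2)] assms(4) in auto)

lemma disp_const:
  assumes "continuous_on UNIV f" "a \<le> b" "\<And>t. t \<in> {a..b} \<Longrightarrow> f t = c"
  shows "disp f a b = of_real (b - a) * cis c"
proof -
  have "disp f a b = of_real b * cis c - of_real a * cis c"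
    by (rule disp_eqI[OF assms(1,2), where G = "\<lambda>t. of_real t * cis c"])
      (use assms(3) in \<open>auto intro!: derivative_eq_intros\<close>)
  then show ?thesis by (simp add: algebra_simps)
qed

lemma disp_shift:
  assumes "continuous_on UNIV f" "a \<le> b"
  shows "disp (\<lambda>t. w + f (t + c)) a b = cis w * disp f (a + c) (b + c)"
proof -
  have c: "continuous_on UNIV (\<lambda>t. w + f (t + c))"
    by (intro continuous_intros continuous_on_compose2[OF assms(1)]) auto
  have "disp (\<lambda>t. w + f (t + c)) a b = cis w * primitive f (b + c) - cis w * primitive f (a + c)"
  proof (rule disp_eqI[OF c assms(2), where G = "\<lambda>t. cis w * primitive f (t + c)"])
    fix t
    have "((\<lambda>t. t + c) has_vector_derivative 1) (at t within {a..b})"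
      by (auto intro!: derivative_eq_intros)
    from vector_diff_chain_within[OF this primitive_deriv[OF assms(1)]]
    have "((\<lambda>t. primitive f (t + c)) has_vector_derivative cis (f (t + c))) (at t within {a..b})"
      by (simp add: o_def)
    from has_vector_derivative_mult_right[OF this, of "cis w"]
    show "((\<lambda>t. cis w * primitive f (t + c)) has_vector_derivative cis (w + f (t + c))) (at t within {a..b})"
      by (simp add: cis_mult)
  qed
  then show ?thesis by (simp add: disp_def algebra_simps)
qed

lemma disp_stall:
  assumes f: "continuous_on UNIV f" and s: "0 \<le> s" and p: "b \<le> p" "p \<le> e"
  shows "disp (\<lambda>t. f (stall p s t)) b (e + s) = disp f b e + of_real s * cis (f p)"
proof -
  have c: "continuous_on UNIV (\<lambda>t. f (stall p s t))"
    unfolding stall_def by (intro continuous_on_compose2[OF f] continuous_intros) auto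
  have cs: "continuous_on UNIV (\<lambda>t. f (t - s))"
    by (intro continuous_on_compose2[OF f] continuous_intros) auto
  have 1: "disp (\<lambda>t. f (stall p s t)) b p = disp f b p"
    by (rule disp_cong[OF c f p(1)]) (simp add: stall_below s)
  have 2: "disp (\<lambda>t. f (stall p s t)) p (p + s) = of_real s * cis (f p)"
    using disp_const[OF c, of p "p + s" "f p"] s by (simp add: stall_between)
  have "disp (\<lambda>t. f (stall p s t)) (p + s) (e + s) = disp (\<lambda>t. f (t - s)) (p + s) (e + s)"
    by (rule disp_cong[OF c cs]) (use p s in \<open>auto simp: stall_above\<close>)
  also have "\<dots> = disp f p e"
    using disp_shift[OF f, of "p + s" "e + s" 0 "-s"] p(2) by simp
  finally have 3: "disp (\<lambda>t. f (stall p s t)) (p + s) (e + s) = disp f p e" .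
  have "disp (\<lambda>t. f (stall p s t)) b (e + s) = disp (\<lambda>t. f (stall p s t)) b p
    + disp (\<lambda>t. f (stall p s t)) p (p + s) + disp (\<lambda>t. f (stall p s t)) (p + s) (e + s)"
    by (simp add: disp_def)
  also have "\<dots> = disp f b p + of_real s * cis (f p) + disp f p e"
    unfolding 1 2 3 ..
  also have "\<dots> = disp f b e + of_real s * cis (f p)"
    by (simp add: disp_def)
  finally show ?thesis .
qed

section \<open>Constrained curves built from angle functions\<close>

definition angle_curve :: "real^2 \<Rightarrow> real \<Rightarrow> (real \<Rightarrow> real) \<Rightarrow> plane_curve" where
  "angle_curve x L f = (L, restrict (\<lambda>t. x + pt (disp f 0 t)) {0..L})"

lemma fst_angle_curve [simp]: "fst (angle_curve x L f) = L"
  by (simp add: angle_curve_def)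

lemma angle_curve_has_derivative:
  assumes "continuous_on UNIV f" "t \<in> {0..L}"
  shows "(snd (angle_curve x L f) has_vector_derivative pt (cis (f t))) (at t within {0..L})"
proof -
  have "((\<lambda>t. disp f 0 t) has_vector_derivative cis (f t) - 0) (at t within {0..L})"
    unfolding disp_def by (intro has_vector_derivative_diff primitive_deriv[OF assms(1)] has_vector_derivative_const)
  from bounded_linear.has_vector_derivative[OF bounded_linear_pt this]
  have "((\<lambda>t. x + pt (disp f 0 t)) has_vector_derivative 0 + pt (cis (f t))) (at t within {0..L})"
    by (intro has_vector_derivative_add has_vector_derivative_const) simp
  then have "((\<lambda>t. x + pt (disp f 0 t)) has_vector_derivative pt (cis (f t))) (at t within {0..L})"
    by simp
  then show ?thesis
    by (rule has_vector_derivative_transform[OF assms(2), rotated]) (simp add: angle_curve_def)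
qed

lemma tangent_angle_curve:
  assumes "continuous_on UNIV f" "0 < L" "t \<in> {0..L}"
  shows "tangent (angle_curve x L f) t = pt (cis (f t))"
  unfolding tangent_def fst_angle_curve
  using vector_derivative_within_cbox[of 0 L t "snd (angle_curve x L f)" "pt (cis (f t))"]
    angle_curve_has_derivative[OF assms(1,3), of x] assms(2,3)
  by simp

lemma at_within_Icc_nontrivial:
  fixes a b t :: real
  assumes "a < b" "t \<in> {a..b}"
  shows "at t within {a..b} \<noteq> bot"
  using assms by (auto simp: trivial_limit_within intro!: islimpt_closure_open[where s="{a<..<b}"])

text \<open>The difference quotients are bounded by \<open>k\<close>, and the bound passes to the
  limit because \<open>at t within {a..b}\<close> is a nontrivial filter even at the end points.
  One-sided derivatives are thus covered.\<close>

lemma norm_derivative_le_lipschitz: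
  fixes g :: "real \<Rightarrow> 'a::real_normed_vector"
  assumes ab: "a < b" "t \<in> {a..b}"
    and g: "(g has_vector_derivative w) (at t within {a..b})"
    and l: "\<And>s. s \<in> {a..b} \<Longrightarrow> norm (g s - g t) \<le> k * \<bar>s - t\<bar>"
  shows "norm w \<le> k"
proof (rule field_le_epsilon)
  fix e :: real assume e: "0 < e"
  have "eventually (\<lambda>s. norm (g s - g t - (s - t) *\<^sub>R w) \<le> e * norm (s - t)) (at t within {a..b})"
    using g e unfolding has_vector_derivative_def has_derivative_within_alt2 by blast
  then have "eventually (\<lambda>s. norm w \<le> k + e) (at t within {a..b})"
    unfolding eventually_at_filter
  proof (rule eventually_mono, intro impI)
    fix s assume s: "s \<noteq> t \<longrightarrow> s \<in> {a..b} \<longrightarrow> norm (g s - g t - (s - t) *\<^sub>R w) \<le> e * norm (s - t)"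
      and st: "s \<noteq> t" "s \<in> {a..b}"
    have "\<bar>s - t\<bar> * norm w = norm ((s - t) *\<^sub>R w)" by simp
    also have "\<dots> \<le> norm (g s - g t) + norm (g s - g t - (s - t) *\<^sub>R w)"
      by (metis add.commute diff_add_cancel norm_minus_commute norm_triangle_sub)
    also have "\<dots> \<le> \<bar>s - t\<bar> * (k + e)"
      using s st l[OF st(2)] by (simp add: algebra_simps)
    finally show "norm w \<le> k + e" using st(1) by simp
  qed
  then show "norm w \<le> k + e"
    using eventually_const_iff at_within_Icc_nontrivial[OF ab] by metis
qed

text \<open>Turns a finite exceptional set into the subdivision that
  \<open>piecewise_C2_curve\<close> asks for. The induction runs on the number of exceptional points
  inside and cuts at the largest one.\<close>

lemma partition_avoiding:
  assumes "finite S" "0 < (L::real)"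
  shows "\<exists>(n::nat) p. p 0 = 0 \<and> p n = L \<and>
    (\<forall>i<n. p i < p (Suc i) \<and> 0 \<le> p i \<and> p (Suc i) \<le> L \<and> {p i<..<p (Suc i)} \<inter> S = {})"
  using assms(2)
proof (induction "card (S \<inter> {0<..<L})" arbitrary: L rule: less_induct)
  case less
  have fin: "finite (S \<inter> {0<..<L})" using assms(1) by simp
  show ?case
  proof (cases "S \<inter> {0<..<L} = {}")
    case True
    show ?thesis
      by (rule exI[of _ 1], rule exI[of _ "\<lambda>i. if i = 0 then 0 else L"])
        (use True less.prems in auto)
  next
    case False
    define s where "s = Max (S \<inter> {0<..<L})"
    have s: "s \<in> S \<inter> {0<..<L}" unfolding s_def by (rule Max_in[OF fin False])
    have max: "u \<le> s" if "u \<in> S \<inter> {0<..<L}" for u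
      unfolding s_def by (rule Max_ge[OF fin that])
    have "S \<inter> {0<..<s} \<subset> S \<inter> {0<..<L}" using s by auto
    then have "card (S \<inter> {0<..<s}) < card (S \<inter> {0<..<L})" by (rule psubset_card_mono[OF fin])
    then obtain n p where p: "p 0 = 0" "p n = s"
      "\<And>i. i < n \<Longrightarrow> p i < p (Suc i) \<and> 0 \<le> p i \<and> p (Suc i) \<le> s \<and> {p i<..<p (Suc i)} \<inter> S = {}"
      using less.hyps[of s] s by auto
    have gap: "{s<..<L} \<inter> S = {}" using max s by force
    show ?thesis
    proof (intro exI[of _ "Suc n"] exI[of _ "p(Suc n := L)"] conjI allI impI)
      fix i assume i: "i < Suc n"
      let ?q = "p(Suc n := L)"
      have "?q i < ?q (Suc i) \<and> 0 \<le> ?q i \<and> ?q (Suc i) \<le> L \<and> {?q i<..<?q (Suc i)} \<inter> S = {}"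
        using p(2) p(3)[of i] s gap i by (cases "i = n") auto
      then show "?q i < ?q (Suc i)" "0 \<le> ?q i" "?q (Suc i) \<le> L" "{?q i<..<?q (Suc i)} \<inter> S = {}"
        by blast+
    qed (use p(1) in auto)
  qed
qed

lemma angle_curve_in_constrained_curves:
  assumes f: "angular \<kappa> f" and L: "0 < L" and d: "disp f 0 L = cx (y - x)"
  shows "angle_curve x L f \<in> constrained_curves \<kappa> x y"
proof -
  let ?c = "angle_curve x L f"
  have c: "continuous_on UNIV f" by (rule angular_continuous[OF f])
  note D = angle_curve_has_derivative[OF c, of _ L x] and T = tangent_angle_curve[OF c L, of _ x]
  have C1: "C1_curve ?c"
    unfolding C1_curve_def fst_angle_curve
  proof
    show "\<forall>t\<in>{0..L}. snd ?c differentiable at t within {0..L}"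
      using D differentiableI_vector by blast
    have "continuous_on {0..L} (\<lambda>t. pt (cis (f t)))"
      by (intro bounded_linear.continuous_on[OF bounded_linear_pt] continuous_intros angular_continuous[OF f])
    then show "continuous_on {0..L} (tangent ?c)"
      by (rule continuous_on_eq) (simp add: T)
  qed
  have seg: "C2_on_segment (snd ?c) a b" if "C1_on f a b" "0 \<le> a" "b \<le> L" for a b
  proof -
    obtain f' where f': "\<And>t. t \<in> {a..b} \<Longrightarrow> (f has_vector_derivative f' t) (at t within {a..b})"
      "continuous_on {a..b} f'"
      using \<open>C1_on f a b\<close> unfolding C1_on_def by blast
    have sub: "{a..b} \<subseteq> {0..L}" using that by auto
    have "((\<lambda>t. pt (cis (f t))) has_vector_derivative pt (f' t *\<^sub>R (\<i> * cis (f t)))) (at t within {a..b})"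
      if "t \<in> {a..b}" for t
    proof (rule bounded_linear.has_vector_derivative[OF bounded_linear_pt])
      show "((\<lambda>t. cis (f t)) has_vector_derivative f' t *\<^sub>R (\<i> * cis (f t))) (at t within {a..b})"
        using has_derivative_cis[OF f'(1)[OF that, unfolded has_vector_derivative_def]]
        unfolding has_vector_derivative_def by simp
    qed
    moreover have "continuous_on {a..b} (\<lambda>t. pt (f' t *\<^sub>R (\<i> * cis (f t))))"
      by (intro bounded_linear.continuous_on[OF bounded_linear_pt] continuous_intros f'(2) angular_continuous[OF f])
    moreover have "(snd ?c has_vector_derivative pt (cis (f t))) (at t within {a..b})" if "t \<in> {a..b}" for t
      using D[of t] that sub has_vector_derivative_within_subset by blast
    ultimately show ?thesis unfolding C2_on_segment_def
      by (intro exI[of _ "\<lambda>t. pt (cis (f t))"] exI[of _ "\<lambda>t. pt (f' t *\<^sub>R (\<i> * cis (f t)))"]) auto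
  qed
  obtain S where S: "finite S" "\<And>a b. a < b \<Longrightarrow> {a<..<b} \<inter> S = {} \<Longrightarrow> C1_on f a b"
    using f unfolding angular_def pw_C1_def by blast
  have "piecewise_C2_curve ?c"
  proof -
    obtain n :: nat and p where "p 0 = 0" "p n = L"
      "\<And>i. i < n \<Longrightarrow> p i < p (Suc i) \<and> 0 \<le> p i \<and> p (Suc i) \<le> L \<and> {p i<..<p (Suc i)} \<inter> S = {}"
      using partition_avoiding[OF S(1) L] by blast
    then show ?thesis
      unfolding piecewise_C2_curve_def fst_angle_curve
      using seg S(2) by (intro exI[of _ n] exI[of _ p]) auto
  qed
  \<comment> \<open>The bound comes from the Lipschitz estimate rather than from a formula for the
    second derivative, so breakpoints and end points need no separate treatment.\<close>
  moreover have "norm a \<le> \<kappa>" if t: "t \<in> {0..L}"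
    and a: "(tangent ?c has_vector_derivative a) (at t within {0..L})" for t a
  proof (rule norm_derivative_le_lipschitz[OF L t a])
    fix s assume s: "s \<in> {0..L}"
    have "norm (tangent ?c s - tangent ?c t) = norm (cis (f s) - cis (f t))"
      using T[OF s] T[OF t] by (metis norm_pt pt_diff)
    also have "\<dots> \<le> \<bar>f s - f t\<bar>" by (rule dist_cis_le)
    also have "\<dots> \<le> \<kappa> * \<bar>s - t\<bar>" by (rule angularD[OF f])
    finally show "norm (tangent ?c s - tangent ?c t) \<le> \<kappa> * \<bar>s - t\<bar>" .
  qed
  ultimately have "constrained_curve \<kappa> ?c"
    unfolding constrained_curve_def using C1 L T by simp
  moreover have "snd ?c 0 = x" "snd ?c L = y"
    using L d by (auto simp: angle_curve_def)
  ultimately show ?thesis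
    unfolding constrained_curves_def by (simp add: angle_curve_def)
qed

section \<open>The \<open>C^1\<close> metric: lengths and continuous families\<close>

text \<open>Both curves start at \<open>x\<close>, so by the mean value inequality a bound on the
  velocities also bounds the positions; this accounts for the factor 2.\<close>

lemma C1_dist_le:
  assumes c: "c \<in> constrained_curves \<kappa> x y" and c': "c' \<in> constrained_curves \<kappa> x y"
    and e: "\<And>u. u \<in> {0..1} \<Longrightarrow> dist (rescaled_velocity c u) (rescaled_velocity c' u) \<le> e"
  shows "C1_dist c c' \<le> 2 * e"
proof -
  have C: "C1_curve b" "0 < fst b" "snd b 0 = x" if "b \<in> constrained_curves \<kappa> x y" for b
    using that by (auto simp: constrained_curves_def constrained_curve_def)
  have e0: "0 \<le> e" using e[of 0] order_trans[OF zero_le_dist] by auto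
  have der: "(rescaled b has_vector_derivative rescaled_velocity b u) (at u within {0..1})"
    if "b \<in> constrained_curves \<kappa> x y" "u \<in> {0..1}" for b u
    using rescaled_has_velocity[OF C(1,2)[OF that(1)] that(2)] rescaled_velocity_eq[OF C(1,2)[OF that(1)] that(2)] by simp
  have pos: "dist (rescaled c u) (rescaled c' u) \<le> e" if u: "u \<in> {0..1}" for u
  proof -
    let ?g = "\<lambda>u. rescaled c u - rescaled c' u"
    have "norm (?g u - ?g 0) \<le> e * norm (u - 0)"
    proof (rule differentiable_bound)
      show "(?g has_derivative (\<lambda>h. h *\<^sub>R (rescaled_velocity c t - rescaled_velocity c' t))) (at t within {0..1})"
        if "t \<in> {0..1}" for t
        using has_vector_derivative_diff[OF der[OF c that] der[OF c' that]]
        unfolding has_vector_derivative_def .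
      show "onorm (\<lambda>h. h *\<^sub>R (rescaled_velocity c t - rescaled_velocity c' t)) \<le> e" if "t \<in> {0..1}" for t
      proof (rule onorm_le)
        show "norm (h *\<^sub>R (rescaled_velocity c t - rescaled_velocity c' t)) \<le> e * norm h" for h
          using mult_right_mono[OF e[OF that], of "norm h"] by (simp add: dist_norm mult.commute)
      qed
    qed (use u in auto)
    moreover have "?g 0 = 0" using C(3)[OF c] C(3)[OF c'] by (simp add: rescaled_def)
    moreover have "e * norm (u - 0) \<le> e" using u e0 by (simp add: mult_left_le)
    ultimately show ?thesis by (simp add: dist_norm)
  qed
  have "(SUP u\<in>{0..1}. dist (rescaled c u) (rescaled c' u)) \<le> e"
    by (rule cSUP_least) (use pos in auto)
  moreover have "(SUP u\<in>{0..1}. dist (rescaled_velocity c u) (rescaled_velocity c' u)) \<le> e"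
    by (rule cSUP_least) (use e in auto)
  moreover have "0 \<le> (SUP u\<in>{0..1}. dist (rescaled c u) (rescaled c' u))"
    using order_trans[OF zero_le_dist sup_dist_upper[OF continuous_on_rescaled[OF C(1,2)[OF c]] continuous_on_rescaled[OF C(1,2)[OF c']], of 0]]
    by simp
  moreover have "0 \<le> (SUP u\<in>{0..1}. dist (rescaled_velocity c u) (rescaled_velocity c' u))"
    using order_trans[OF zero_le_dist sup_dist_upper[OF continuous_on_rescaled_velocity[OF C(1,2)[OF c]] continuous_on_rescaled_velocity[OF C(1,2)[OF c']], of 0]]
    by simp
  ultimately show ?thesis unfolding C1_dist_def by linarith
qed

text \<open>The rescaled velocity has norm equal to the length of the curve, so the velocity part of
  the metric controls lengths; evaluation at \<open>0\<close> suffices.\<close>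

lemma length_diff_le_C1_dist:
  assumes c: "c \<in> constrained_curves \<kappa> x y" and c': "c' \<in> constrained_curves \<kappa> x y"
  shows "\<bar>fst c - fst c'\<bar> \<le> C1_dist c c'"
proof -
  have C: "C1_curve b" "0 < fst b" "norm (tangent b 0) = 1" if "b \<in> constrained_curves \<kappa> x y" for b
    using that by (auto simp: constrained_curves_def constrained_curve_def)
  have len: "fst b = norm (rescaled_velocity b 0)" if "b \<in> constrained_curves \<kappa> x y" for b
    using rescaled_velocity_eq[OF C(1,2)[OF that], of 0] C[OF that] by simp
  have "\<bar>fst c - fst c'\<bar> \<le> dist (rescaled_velocity c 0) (rescaled_velocity c' 0)"
    unfolding len[OF c] len[OF c'] dist_norm by (rule norm_triangle_ineq3)
  also have "\<dots> \<le> (SUP u\<in>{0..1}. dist (rescaled_velocity c u) (rescaled_velocity c' u))"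
    by (rule sup_dist_upper[OF continuous_on_rescaled_velocity[OF C(1,2)[OF c]] continuous_on_rescaled_velocity[OF C(1,2)[OF c']]]) simp
  also have "\<dots> \<le> C1_dist c c'"
  proof -
    have "0 \<le> (SUP u\<in>{0..1}. dist (rescaled c u) (rescaled c' u))"
      using order_trans[OF zero_le_dist sup_dist_upper[OF continuous_on_rescaled[OF C(1,2)[OF c]] continuous_on_rescaled[OF C(1,2)[OF c']], of 0]]
      by simp
    then show ?thesis unfolding C1_dist_def by linarith
  qed
  finally show ?thesis .
qed

text \<open>The intermediate value theorem for the length along a homotopy. This is the obstruction
  that later keeps two classes apart.\<close>

lemma homotopic_length_attained:
  assumes h: "(c, c') \<in> constrained_homotopic \<kappa> x y" and l: "fst c \<le> l" "l \<le> fst c'"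
  shows "\<exists>b\<in>constrained_curves \<kappa> x y. fst b = l"
proof -
  have "\<exists>H. constrained_homotopy \<kappa> x y H c c'"
    using h unfolding constrained_homotopic_def by simp
  then obtain H where "constrained_homotopy \<kappa> x y H c c'" by (rule exE)
  then have H: "continuous_map (top_of_set {0..1}) (curve_topology \<kappa> x y) H" "H 0 = c" "H 1 = c'"
    unfolding constrained_homotopy_def by simp_all
  have curves: "H t \<in> constrained_curves \<kappa> x y" if "t \<in> {0..1}" for t
    using continuous_map_image_subset_topspace[OF H(1)] that
    unfolding topspace_curve_topology topspace_euclidean_subtopology by blast
  have "continuous_map (curve_topology \<kappa> x y) euclideanreal fst"
    unfolding curve_topology_def Metric_space.continuous_map_from_metric[OF Metric_space_constrained_curves]
  proof (intro conjI ballI allI impI; (simp; fail)?)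
    fix a and U :: "real set" assume a: "a \<in> constrained_curves \<kappa> x y" and U: "openin euclideanreal U \<and> fst a \<in> U"
    then have "open U" "fst a \<in> U" by simp_all
    then obtain e where e: "e > 0" "ball (fst a) e \<subseteq> U" using openE by blast
    show "\<exists>r>0. \<forall>b. b \<in> constrained_curves \<kappa> x y \<and> C1_dist a b < r \<longrightarrow> fst b \<in> U"
    proof (intro exI conjI allI impI)
      fix b assume "b \<in> constrained_curves \<kappa> x y \<and> C1_dist a b < e"
      then have "fst b \<in> ball (fst a) e" using length_diff_le_C1_dist[OF a, of b] by (simp add: dist_real_def)
      then show "fst b \<in> U" using e(2) by blast
    qed (rule e(1))
  qed
  from continuous_map_compose[OF H(1) this]
  have "continuous_on {0..1} (fst \<circ> H)" by simp
  moreover have "(fst \<circ> H) 0 \<le> l" "l \<le> (fst \<circ> H) 1" using l H(2,3) by simp_all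
  ultimately obtain t where t: "0 \<le> t" "t \<le> 1" "(fst \<circ> H) t = l"
    using IVT'[of "fst \<circ> H" 0 l 1] by auto
  show ?thesis by (rule bexI[of _ "H t"]) (use t curves[of t] in auto)
qed

text \<open>The rescaled velocity at \<open>(\<tau>, u)\<close> is jointly continuous on the compact
  unit square, hence uniformly continuous; nearby values of \<open>\<tau>\<close> then give
  velocities that are uniformly close in \<open>u\<close>.\<close>

lemma angle_curve_family_homotopic:
  fixes L :: "real \<Rightarrow> real" and \<Theta> :: "real \<Rightarrow> real \<Rightarrow> real"
  assumes L: "continuous_on {0..1} L" "\<And>\<tau>. \<tau> \<in> {0..1} \<Longrightarrow> 0 < L \<tau>"
    and \<Theta>: "continuous_on ({0..1} \<times> UNIV) (\<lambda>(\<tau>, u). \<Theta> \<tau> u)" "\<And>\<tau>. \<tau> \<in> {0..1} \<Longrightarrow> angular \<kappa> (\<Theta> \<tau>)"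
    and d: "\<And>\<tau>. \<tau> \<in> {0..1} \<Longrightarrow> disp (\<Theta> \<tau>) 0 (L \<tau>) = cx (y - x)"
  shows "(angle_curve x (L 0) (\<Theta> 0), angle_curve x (L 1) (\<Theta> 1)) \<in> constrained_homotopic \<kappa> x y"
proof -
  define H where "H \<tau> = angle_curve x (L \<tau>) (\<Theta> \<tau>)" for \<tau>
  have H: "H \<tau> \<in> constrained_curves \<kappa> x y" if "\<tau> \<in> {0..1}" for \<tau>
    unfolding H_def by (rule angle_curve_in_constrained_curves[OF \<Theta>(2)[OF that] L(2)[OF that] d[OF that]])
  define V where "V = (\<lambda>(\<tau>, u). L \<tau> *\<^sub>R pt (cis (\<Theta> \<tau> (L \<tau> * u))))"
  have vel: "rescaled_velocity (H \<tau>) u = V (\<tau>, u)" if "\<tau> \<in> {0..1}" "u \<in> {0..1}" for \<tau> u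
  proof -
    have "L \<tau> * u \<in> {0..L \<tau>}" using L(2)[OF that(1)] that(2) by (simp add: mult_left_le)
    moreover have "C1_curve (H \<tau>)" using H[OF that(1)] by (auto simp: constrained_curves_def constrained_curve_def)
    ultimately show ?thesis
      using rescaled_velocity_eq[of "H \<tau>" u] tangent_angle_curve[OF angular_continuous[OF \<Theta>(2)[OF that(1)]] L(2)[OF that(1)]] L(2)[OF that(1)] that(2)
      by (simp add: H_def V_def)
  qed
  have "continuous_on ({0..1} \<times> {0..1}) V"
  proof -
    have cL: "continuous_on ({0..1} \<times> {0..1}) (\<lambda>q::real\<times>real. L (fst q))"
      by (rule continuous_on_compose2[OF L(1)]) (auto intro!: continuous_intros)
    have "continuous_on ({0..1} \<times> {0..1}) (\<lambda>q::real\<times>real. (\<lambda>(\<tau>, u). \<Theta> \<tau> u) (fst q, L (fst q) * snd q))"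
      by (rule continuous_on_compose2[OF \<Theta>(1)]) (auto intro!: continuous_intros cL)
    then have "continuous_on ({0..1} \<times> {0..1}) (\<lambda>q::real\<times>real. L (fst q) *\<^sub>R pt (cis (\<Theta> (fst q) (L (fst q) * snd q))))"
      by (intro continuous_intros cL bounded_linear.continuous_on[OF bounded_linear_pt]) auto
    then show ?thesis unfolding V_def by (simp add: case_prod_beta')
  qed
  then have uc: "uniformly_continuous_on ({0..1} \<times> {0..1}) V"
    by (rule compact_uniformly_continuous) (intro compact_Times compact_Icc)
  have "continuous_map (top_of_set {0..1}) (curve_topology \<kappa> x y) H"
    unfolding curve_topology_def Metric_space.continuous_map_to_metric[OF Metric_space_constrained_curves]
  proof (intro ballI allI impI)
    fix t and e :: real assume "t \<in> topspace (top_of_set {0..1::real})" and e: "0 < e"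
    then have t: "t \<in> {0..1}" by simp
    \<comment> \<open>\<open>C1_dist_le\<close> doubles the velocity bound, and the ball is open:
      \<open>2 * (e / 4) < e\<close>.\<close>
    have e4: "0 < e / 4" using e by simp
    from uc[unfolded uniformly_continuous_on_def, rule_format, OF this] obtain \<delta> where \<delta>: "\<delta> > 0"
      "\<And>q q'. q \<in> {0..1} \<times> {0..1} \<Longrightarrow> q' \<in> {0..1} \<times> {0..1} \<Longrightarrow> dist q' q < \<delta> \<Longrightarrow> dist (V q') (V q) < e / 4"
      by meson
    show "\<exists>U. openin (top_of_set {0..1}) U \<and> t \<in> U \<and>
      (\<forall>s\<in>U. H s \<in> Metric_space.mball (constrained_curves \<kappa> x y) C1_dist (H t) e)"
    proof (intro exI conjI ballI)
      show "openin (top_of_set {0..1}) ({0..1} \<inter> ball t \<delta>)" by (simp add: openin_open_Int)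
      show "t \<in> {0..1} \<inter> ball t \<delta>" using t \<delta>(1) by simp
      fix s assume s: "s \<in> {0..1} \<inter> ball t \<delta>"
      have "C1_dist (H t) (H s) \<le> 2 * (e / 4)"
      proof (rule C1_dist_le[OF H[OF t] H])
        fix u :: real assume u: "u \<in> {0..1}"
        have "dist (V (t, u)) (V (s, u)) < e / 4"
          by (rule \<delta>(2)) (use s t u in \<open>auto simp: dist_Pair_Pair\<close>)
        then show "dist (rescaled_velocity (H t) u) (rescaled_velocity (H s) u) \<le> e / 4"
          using vel t s u by simp
      qed (use s in simp)
      then show "H s \<in> Metric_space.mball (constrained_curves \<kappa> x y) C1_dist (H t) e"
        unfolding Metric_space.in_mball[OF Metric_space_constrained_curves]
        using H[OF t] H[of s] s e by simp
    qed
  qed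
  then have "constrained_homotopy \<kappa> x y H (H 0) (H 1)"
    unfolding constrained_homotopy_def by simp
  then show ?thesis unfolding constrained_homotopic_def H_def[symmetric] using H[of 0] H[of 1] by auto
qed

section \<open>Lifting a constrained curve to an angle function\<close>

text \<open>While a continuous angle stays within \<open>pi / 2\<close> of
  \<open>\<theta> t\<close>, it equals \<open>\<theta> t\<close> plus the \<open>arcsin\<close> of
  the imaginary part of the direction relative to \<open>cis (\<theta> t)\<close>. It is therefore
  differentiable wherever the direction is.\<close>

lemma angle_has_derivative:
  assumes c: "continuous_on A \<theta>" and t: "t \<in> A"
    and d: "((\<lambda>s. cis (\<theta> s)) has_vector_derivative w) (at t within A)"
  shows "(\<theta> has_vector_derivative Im (w * cis (- \<theta> t))) (at t within A)"
proof -
  obtain e where e: "e > 0" "\<And>s. s \<in> A \<Longrightarrow> dist s t < e \<Longrightarrow> dist (\<theta> s) (\<theta> t) < pi / 2"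
    using c t pi_half_gt_zero unfolding continuous_on_iff by blast
  have 1: "((\<lambda>s. Im (cis (\<theta> s) * cis (- \<theta> t))) has_vector_derivative Im (w * cis (- \<theta> t))) (at t within A)"
    by (intro bounded_linear.has_vector_derivative[OF bounded_linear_Im] has_vector_derivative_mult_left d)
  have "(arcsin has_real_derivative inverse (sqrt (1 - 0\<^sup>2))) (at 0)"
    by (rule DERIV_arcsin) auto
  then have 2: "(arcsin has_vector_derivative 1) (at (Im (cis (\<theta> t) * cis (- \<theta> t))) within B)" for B
    using has_vector_derivative_at_within
    by (simp add: has_real_derivative_iff_has_vector_derivative cis_mult) blast
  have "((\<lambda>s. arcsin (Im (cis (\<theta> s) * cis (- \<theta> t)))) has_vector_derivative Im (w * cis (- \<theta> t))) (at t within A)"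
    using vector_diff_chain_within[OF 1 2] by (simp add: o_def)
  from has_vector_derivative_add[OF has_vector_derivative_const[of "\<theta> t"] this]
  have 3: "((\<lambda>s. \<theta> t + arcsin (Im (cis (\<theta> s) * cis (- \<theta> t)))) has_vector_derivative Im (w * cis (- \<theta> t))) (at t within A)"
    by simp
  show ?thesis
  proof (rule has_vector_derivative_transform_within[OF 3 e(1) t])
    fix s assume s: "s \<in> A" "dist s t < e"
    have "\<bar>\<theta> s - \<theta> t\<bar> < pi / 2" using e(2)[OF s] by (simp add: dist_real_def)
    then have "arcsin (sin (\<theta> s - \<theta> t)) = \<theta> s - \<theta> t"
      by (intro arcsin_sin; linarith)
    then show "\<theta> t + arcsin (Im (cis (\<theta> s) * cis (- \<theta> t))) = \<theta> s"
      by (simp add: cis_mult)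
  qed
qed

lemma lipschitz_on_derivative_bound:
  fixes f :: "real \<Rightarrow> real"
  assumes c: "continuous_on {a..b} f" and k: "0 \<le> k"
    and d: "\<And>t. a < t \<Longrightarrow> t < b \<Longrightarrow> (f has_vector_derivative f' t) (at t)"
    and b: "\<And>t. a < t \<Longrightarrow> t < b \<Longrightarrow> \<bar>f' t\<bar> \<le> k"
  shows "k-lipschitz_on {a..b} f"
proof (rule lipschitz_on_leI)
  fix s t assume s: "s \<in> {a..b}" and t: "t \<in> {a..b}" and st: "s \<le> t"
  show "dist (f s) (f t) \<le> k * dist s t"
  proof (cases "s = t")
    case False
    have "\<exists>\<xi>\<in>{s<..<t}. f t - f s = (\<lambda>h. h *\<^sub>R f' \<xi>) (t - s)"
    proof (rule mvt)
      show "s < t" using False st by simp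
      show "continuous_on {s..t} f" using continuous_on_subset[OF c] s t by auto
      show "(f has_derivative (\<lambda>h. h *\<^sub>R f' u)) (at u)" if "s < u" "u < t" for u
        using d[of u] that s t by (simp add: has_vector_derivative_def)
    qed auto
    then obtain u where u: "s < u" "u < t" "f t - f s = (t - s) * f' u" by auto
    have "\<bar>f t - f s\<bar> \<le> (t - s) * k"
      using u b[of u] s t by (simp add: abs_mult)
    then show ?thesis using st by (simp add: dist_real_def abs_minus_commute mult.commute)
  qed simp
qed (rule k)

text \<open>Converse of \<open>angle_curve_in_constrained_curves\<close>, which moves the whole
  problem to angle functions. The angle is \<open>C^1\<close> on each segment where the curve is
  \<open>C^2\<close>, the curvature bound makes it Lipschitz there, and Lipschitz bounds concatenate
  across breakpoints.\<close>

lemma constrained_curve_as_angle_curve: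
  assumes k: "0 \<le> \<kappa>" and c: "c \<in> constrained_curves \<kappa> x y"
  shows "\<exists>f. angular \<kappa> f \<and> 0 < fst c \<and> c = angle_curve x (fst c) f \<and> disp f 0 (fst c) = cx (y - x)"
proof -
  obtain L \<sigma> where cL: "c = (L, \<sigma>)" by (cases c)
  define T where "T = tangent c"
  have L: "0 < L" and C1: "C1_curve c" and pw: "piecewise_C2_curve c"
    and nT: "\<And>t. t \<in> {0..L} \<Longrightarrow> norm (T t) = 1"
    and bT: "\<And>t a. t \<in> {0..L} \<Longrightarrow> (T has_vector_derivative a) (at t within {0..L}) \<Longrightarrow> norm a \<le> \<kappa>"
    and ext: "\<sigma> \<in> extensional {0..L}" and ends: "\<sigma> 0 = x" "\<sigma> L = y"
    using c unfolding cL constrained_curves_def constrained_curve_def T_def by auto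
  have dT: "(\<sigma> has_vector_derivative T t) (at t within {0..L})" if "t \<in> {0..L}" for t
    using C1 that unfolding C1_curve_def T_def tangent_def cL by (simp add: vector_derivative_works)
  have cT: "continuous_on {0..L} T"
    using C1 unfolding C1_curve_def T_def cL by simp
  have "continuous_on {0..L} (\<lambda>t. cx (T t))"
    by (rule bounded_linear.continuous_on[OF bounded_linear_cx cT])
  moreover have "contractible {0..L}" by (rule convex_imp_contractible) simp
  moreover have "cx (T t) \<noteq> 0" if "t \<in> {0..L}" for t
    using nT[OF that] by (metis norm_cx norm_zero zero_neq_one)
  \<comment> \<open>A continuous logarithm of the tangent. Its real part vanishes because tangents
    are unit vectors, and its imaginary part is the angle.\<close>
  ultimately obtain g where g: "continuous_on {0..L} g" "\<And>t. t \<in> {0..L} \<Longrightarrow> cx (T t) = exp (g t)"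
    using continuous_logarithm_on_contractible by blast
  define \<theta> where "\<theta> t = Im (g t)" for t
  have c\<theta>: "continuous_on {0..L} \<theta>" unfolding \<theta>_def by (intro continuous_intros g(1))
  have z: "cx (T t) = cis (\<theta> t)" if "t \<in> {0..L}" for t
  proof -
    have "exp (Re (g t)) = 1" using nT[OF that] g(2)[OF that] by (metis norm_cx norm_exp_eq_Re)
    then have "Re (g t) = 0" by simp
    then show ?thesis unfolding g(2)[OF that] \<theta>_def by (simp add: exp_eq_polar)
  qed
  obtain n :: nat and p where p0: "p 0 = 0" and pn: "p n = L"
    and pp: "\<And>i. i < n \<Longrightarrow> p i < p (Suc i)" and seg: "\<And>i. i < n \<Longrightarrow> C2_on_segment \<sigma> (p i) (p (Suc i))"
    using pw unfolding piecewise_C2_curve_def cL by auto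
  have mono: "p i \<le> p j" if "i \<le> j" "j \<le> n" for i j
    using that
  proof (induction j rule: dec_induct)
    case (step j)
    then show ?case using pp[of j] by simp
  qed simp
  have piece: "\<exists>\<theta>'. (\<forall>t\<in>{p i..p (Suc i)}. (\<theta> has_vector_derivative \<theta>' t) (at t within {p i..p (Suc i)}) \<and>
      (p i < t \<longrightarrow> t < p (Suc i) \<longrightarrow> \<bar>\<theta>' t\<bar> \<le> \<kappa>)) \<and> continuous_on {p i..p (Suc i)} \<theta>'"
    if i: "i < n" for i
  proof -
    define I where "I = {p i..p (Suc i)}"
    have sub: "I \<subseteq> {0..L}" using mono[of 0 i] mono[of "Suc i" n] i p0 pn unfolding I_def by auto
    obtain f' f'' where f: "\<And>t. t \<in> I \<Longrightarrow> (\<sigma> has_vector_derivative f' t) (at t within I)"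
      "\<And>t. t \<in> I \<Longrightarrow> (f' has_vector_derivative f'' t) (at t within I)" "continuous_on I f''"
      using seg[OF i] unfolding C2_on_segment_def I_def by blast
    have eq: "f' t = T t" if t: "t \<in> I" for t
    proof -
      have "(\<sigma> has_vector_derivative T t) (at t within I)"
        using dT[of t] t sub has_vector_derivative_within_subset by blast
      then show ?thesis
        using vector_derivative_unique_within_closed_interval[of "p i" "p (Suc i)" t \<sigma> "f' t" "T t"] f(1)[OF t] pp[OF i] t
        unfolding I_def by simp
    qed
    have T': "(T has_vector_derivative f'' t) (at t within I)" if t: "t \<in> I" for t
      by (rule has_vector_derivative_transform[OF t _ f(2)[OF t]]) (simp add: eq)
    have ct: "continuous_on I \<theta>" using c\<theta> sub continuous_on_subset by blast
    have th: "(\<theta> has_vector_derivative Im (cx (f'' t) * cis (- \<theta> t))) (at t within I)" if t: "t \<in> I" for t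
    proof (rule angle_has_derivative[OF ct t])
      show "((\<lambda>s. cis (\<theta> s)) has_vector_derivative cx (f'' t)) (at t within I)"
        by (rule has_vector_derivative_transform[OF t _ bounded_linear.has_vector_derivative[OF bounded_linear_cx T'[OF t]]])
          (use z sub in auto)
    qed
    \<comment> \<open>Only interior points: there the derivative within the segment is the
      derivative within \<open>{0..L}\<close>, to which the curvature bound refers. At a breakpoint
      the tangent may fail to be differentiable.\<close>
    have b: "\<bar>Im (cx (f'' t) * cis (- \<theta> t))\<bar> \<le> \<kappa>" if t: "p i < t" "t < p (Suc i)" for t
    proof -
      have tI: "t \<in> interior I" "t \<in> I" using t unfolding I_def by auto
      then have tL: "t \<in> interior {0..L}" using sub interior_mono by blast
      have "(T has_vector_derivative f'' t) (at t within {0..L})"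
        using T'[OF tI(2)] at_within_interior[OF tI(1)] at_within_interior[OF tL] by simp
      then have "norm (f'' t) \<le> \<kappa>" using bT tI(2) sub by blast
      then have "cmod (cx (f'' t) * cis (- \<theta> t)) \<le> \<kappa>" by (simp add: norm_mult)
      then show ?thesis using abs_Im_le_cmod order_trans by blast
    qed
    have "continuous_on I (\<lambda>t. Im (cx (f'' t) * cis (- \<theta> t)))"
      by (intro continuous_intros bounded_linear.continuous_on[OF bounded_linear_cx] f(3) ct)
    then show ?thesis unfolding I_def[symmetric] using th b
      by (intro exI[of _ "\<lambda>t. Im (cx (f'' t) * cis (- \<theta> t))"]) blast
  qed
  have lip_piece: "\<kappa>-lipschitz_on {p i..p (Suc i)} \<theta>" if i: "i < n" for i
  proof -
    obtain \<theta>' where \<theta>': "\<And>t. t \<in> {p i..p (Suc i)} \<Longrightarrow> (\<theta> has_vector_derivative \<theta>' t) (at t within {p i..p (Suc i)})"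
      "\<And>t. p i < t \<Longrightarrow> t < p (Suc i) \<Longrightarrow> \<bar>\<theta>' t\<bar> \<le> \<kappa>"
      using piece[OF i] by fastforce
    show ?thesis
    proof (rule lipschitz_on_derivative_bound[OF _ k])
      show "continuous_on {p i..p (Suc i)} \<theta>"
        using \<theta>'(1) has_vector_derivative_continuous
        unfolding continuous_on_eq_continuous_within by blast
      show "(\<theta> has_vector_derivative \<theta>' t) (at t)" if "p i < t" "t < p (Suc i)" for t
        using \<theta>'(1)[of t] that at_within_interior[of t "{p i..p (Suc i)}"] by simp
    qed (rule \<theta>'(2))
  qed
  have lip: "\<kappa>-lipschitz_on {0..p i} \<theta>" if "i \<le> n" for i
    using that
  proof (induction i)
    case 0
    show ?case unfolding p0 using k by (auto intro!: lipschitz_onI)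
  next
    case (Suc i)
    have "\<kappa>-lipschitz_on {0..p (Suc i)} (\<lambda>t. if t \<le> p i then \<theta> t else \<theta> t)"
      by (rule lipschitz_on_concat) (use Suc lip_piece in auto)
    then show ?case by simp
  qed
  \<comment> \<open>Clamping the argument extends the angle by constants, which keeps the Lipschitz
    constant and adds at most the corners \<open>0\<close> and \<open>L\<close>.\<close>
  define f where "f t = \<theta> (max 0 (min L t))" for t
  have fin: "f t = \<theta> t" if "t \<in> {0..L}" for t using that unfolding f_def by auto
  have lipf: "\<kappa>-lipschitz_on UNIV f"
  proof (rule lipschitz_onI)
    fix s t
    have "dist (f s) (f t) \<le> \<kappa> * dist (max 0 (min L s)) (max 0 (min L t))"
      unfolding f_def using lip[OF order_refl] L unfolding pn by (rule_tac lipschitz_onD) auto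
    also have "\<dots> \<le> \<kappa> * dist s t"
      by (rule mult_left_mono[OF _ k]) (auto simp: dist_real_def)
    finally show "dist (f s) (f t) \<le> \<kappa> * dist s t" .
  qed (rule k)
  have "C1_on f a b" if ab: "a < b" and d: "{a<..<b} \<inter> p ` {..n} = {}" for a b
  proof -
    have no: "\<not> (a < p i \<and> p i < b)" if "i \<le> n" for i
      using d that by (metis IntI atMost_iff emptyE greaterThanLessThan_iff imageI)
    consider "b \<le> 0" | "L \<le> a" | "0 \<le> a" "a < L"
      using no[of 0] p0 ab by linarith
    then show ?thesis
    proof cases
      case 1
      show ?thesis
        by (rule C1_on_cong[OF _ C1_on_affine[of "\<theta> 0" 0]]) (use 1 L in \<open>auto simp: f_def\<close>)
    next
      case 2
      show ?thesis
        by (rule C1_on_cong[OF _ C1_on_affine[of "\<theta> L" 0]]) (use 2 L in \<open>auto simp: f_def max_def min_def\<close>)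
    next
      case 3
      have "\<exists>i<n. p i \<le> a \<and> a < p (Suc i)"
      proof (rule ccontr)
        assume *: "\<not> ?thesis"
        have "p i \<le> a" if "i \<le> n" for i
          using that by (induction i) (use 3 p0 * in \<open>auto simp: not_less\<close>)
        then show False using 3 pn by fastforce
      qed
      then obtain i where i: "i < n" "p i \<le> a" "a < p (Suc i)" by blast
      have sub: "{a..b} \<subseteq> {p i..p (Suc i)}" using no[of "Suc i"] i by auto
      have subL: "{p i..p (Suc i)} \<subseteq> {0..L}" using mono[of 0 i] mono[of "Suc i" n] i p0 pn by auto
      obtain \<theta>' where \<theta>': "\<And>t. t \<in> {p i..p (Suc i)} \<Longrightarrow> (\<theta> has_vector_derivative \<theta>' t) (at t within {p i..p (Suc i)})"
        "continuous_on {p i..p (Suc i)} \<theta>'"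
        using piece[OF i(1)] by fastforce
      have "C1_on \<theta> a b" unfolding C1_on_def
        using has_vector_derivative_within_subset[OF \<theta>'(1) sub] continuous_on_subset[OF \<theta>'(2) sub] sub by blast
      then show ?thesis by (rule C1_on_cong[rotated]) (use fin sub subL in auto)
    qed
  qed
  then have ang: "angular \<kappa> f"
    unfolding angular_def pw_C1_def using lipf by (intro conjI exI[of _ "p ` {..n}"]) auto
  have disp: "disp f 0 t = cx (\<sigma> t - x)" if t: "t \<in> {0..L}" for t
  proof -
    have "disp f 0 t = cx (\<sigma> t) - cx (\<sigma> 0)"
    proof (rule disp_eqI[OF angular_continuous[OF ang]])
      fix s assume s: "s \<in> {0..t}"
      have "((\<lambda>s. cx (\<sigma> s)) has_vector_derivative cx (T s)) (at s within {0..L})"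
        by (rule bounded_linear.has_vector_derivative[OF bounded_linear_cx dT]) (use s t in auto)
      then have "((\<lambda>s. cx (\<sigma> s)) has_vector_derivative cx (T s)) (at s within {0..t})"
        by (rule has_vector_derivative_within_subset) (use t in auto)
      then show "((\<lambda>s. cx (\<sigma> s)) has_vector_derivative cis (f s)) (at s within {0..t})"
        using z[of s] fin[of s] s t by simp
    qed (use t in simp)
    then show ?thesis by (simp add: ends(1) cx_diff)
  qed
  have "\<sigma> = restrict (\<lambda>t. x + pt (disp f 0 t)) {0..L}"
    by (rule extensionalityI[OF ext]) (auto simp: disp)
  then have "c = angle_curve x (fst c) f" unfolding cL angle_curve_def by simp
  moreover have "fst c = L" by (simp add: cL)
  ultimately show ?thesis using ang L disp[of L] ends(2) by (intro exI[of _ f]) simp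
qed

lemma angle_curve_cong:
  assumes "continuous_on UNIV f" "continuous_on UNIV g"
    and "\<And>t. t \<in> {0..L} \<Longrightarrow> cis (f t) = cis (g t)"
  shows "angle_curve x L f = angle_curve x L g"
proof -
  have "disp f 0 t = disp g 0 t" if t: "t \<in> {0..L}" for t
    unfolding disp_def[of g]
  proof (rule disp_eqI[OF assms(1)])
    fix u assume u: "u \<in> {0..t}"
    show "(primitive g has_vector_derivative cis (f u)) (at u within {0..t})"
      using primitive_deriv[OF assms(2)] assms(3)[of u] u t by simp
  qed (use t in simp)
  then show ?thesis unfolding angle_curve_def by (auto intro!: restrict_ext)
qed

section \<open>Windows with inserted segments and their homotopies\<close>

text \<open>The time of the new curve is first freed of the earliest pause. With
  \<open>p1 \<le> p2 \<le> p3\<close>, all three positions are therefore parameters of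
  \<open>B\<close> itself, and none moves when the length of another pause changes.\<close>

definition stalled :: "(real \<Rightarrow> real) \<Rightarrow> real \<Rightarrow> real \<Rightarrow> real \<Rightarrow> real \<Rightarrow> real \<Rightarrow> real \<Rightarrow> real \<Rightarrow> real" where
  "stalled B p1 s1 p2 s2 p3 s3 t = B (stall p3 s3 (stall p2 s2 (stall p1 s1 t)))"

lemma angular_stalled:
  assumes "angular \<kappa> B" "0 \<le> s1" "0 \<le> s2" "0 \<le> s3"
  shows "angular \<kappa> (stalled B p1 s1 p2 s2 p3 s3)"
  unfolding stalled_def
  by (rule angular_stall[OF angular_stall[OF angular_stall[OF assms(1,4)] assms(3)] assms(2)])

lemma disp_stalled:
  assumes B: "continuous_on UNIV B" and s: "0 \<le> s1" "0 \<le> s2" "0 \<le> s3"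
    and p: "b \<le> p1" "p1 \<le> p2" "p2 \<le> p3" "p3 \<le> e"
  shows "disp (stalled B p1 s1 p2 s2 p3 s3) b (e + s1 + s2 + s3) =
    disp B b e + of_real s1 * cis (B p1) + of_real s2 * cis (B p2) + of_real s3 * cis (B p3)"
proof -
  let ?h = "\<lambda>t. B (stall p3 s3 t)" and ?g = "\<lambda>t. B (stall p3 s3 (stall p2 s2 t))"
  have c: "continuous_on UNIV ?h" "continuous_on UNIV ?g"
    unfolding stall_def by (intro continuous_on_compose2[OF B] continuous_intros; simp)+
  have "disp (stalled B p1 s1 p2 s2 p3 s3) b ((e + s3 + s2) + s1) = disp ?g b (e + s3 + s2) + of_real s1 * cis (?g p1)"
    using disp_stall[OF c(2) s(1), of b p1 "e + s3 + s2"] p s unfolding stalled_def by simp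
  also have "disp ?g b (e + s3 + s2) = disp ?h b (e + s3) + of_real s2 * cis (?h p2)"
    using disp_stall[OF c(1) s(2), of b p2 "e + s3"] p s by simp
  also have "disp ?h b (e + s3) = disp B b e + of_real s3 * cis (B p3)"
    using disp_stall[OF B s(3), of b p3 e] p by simp
  also have "?g p1 = B p1" using p s by (simp add: stall_below)
  also have "?h p2 = B p2" using p s by (simp add: stall_below)
  finally show ?thesis by (simp add: algebra_simps)
qed

text \<open>The turning function \<open>B\<close> restricted to the window \<open>{b..e}\<close>, rotated by \<open>w\<close>, with straight
  segments of lengths \<open>s1, s2, s3\<close> inserted at the parameters \<open>p1 \<le> p2 \<le> p3\<close> of \<open>B\<close>.\<close>

definition window :: "real^2 \<Rightarrow> real \<Rightarrow> (real \<Rightarrow> real) \<Rightarrow> real \<Rightarrow> real \<Rightarrow>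
    real \<Rightarrow> real \<Rightarrow> real \<Rightarrow> real \<Rightarrow> real \<Rightarrow> real \<Rightarrow> plane_curve" where
  "window x w B b e p1 s1 p2 s2 p3 s3 =
     angle_curve x (e - b + s1 + s2 + s3) (\<lambda>u. w + stalled B p1 s1 p2 s2 p3 s3 (u + b))"

lemma disp_window:
  assumes B: "continuous_on UNIV B" and s: "0 \<le> s1" "0 \<le> s2" "0 \<le> s3"
    and p: "b \<le> p1" "p1 \<le> p2" "p2 \<le> p3" "p3 \<le> e"
  shows "disp (\<lambda>u. w + stalled B p1 s1 p2 s2 p3 s3 (u + b)) 0 (e - b + s1 + s2 + s3) =
    cis w * (disp B b e + of_real s1 * cis (B p1) + of_real s2 * cis (B p2) + of_real s3 * cis (B p3))"
proof -
  have c: "continuous_on UNIV (stalled B p1 s1 p2 s2 p3 s3)"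
    unfolding stalled_def stall_def by (intro continuous_on_compose2[OF B] continuous_intros; simp)
  have "disp (\<lambda>u. w + stalled B p1 s1 p2 s2 p3 s3 (u + b)) 0 (e - b + s1 + s2 + s3) =
      cis w * disp (stalled B p1 s1 p2 s2 p3 s3) b (e + s1 + s2 + s3)"
    using disp_shift[OF c, of 0 "e - b + s1 + s2 + s3" w b] s p by (simp add: add.assoc)
  then show ?thesis unfolding disp_stalled[OF B s p] .
qed

text \<open>All deformations below are paths in the nine real parameters of a window; what has to be
  maintained along the path is the order of the parameters, a positive length and the displacement
  equation.\<close>

lemma window_homotopic:
  fixes w b e p1 p2 p3 s1 s2 s3 :: "real \<Rightarrow> real"
  assumes B: "angular \<kappa> B"
    and c: "continuous_on {0..1} w" "continuous_on {0..1} b" "continuous_on {0..1} e"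
      "continuous_on {0..1} p1" "continuous_on {0..1} s1" "continuous_on {0..1} p2"
      "continuous_on {0..1} s2" "continuous_on {0..1} p3" "continuous_on {0..1} s3"
    and p: "\<And>\<tau>. \<tau> \<in> {0..1} \<Longrightarrow> b \<tau> \<le> p1 \<tau>" "\<And>\<tau>. \<tau> \<in> {0..1} \<Longrightarrow> p1 \<tau> \<le> p2 \<tau>"
      "\<And>\<tau>. \<tau> \<in> {0..1} \<Longrightarrow> p2 \<tau> \<le> p3 \<tau>" "\<And>\<tau>. \<tau> \<in> {0..1} \<Longrightarrow> p3 \<tau> \<le> e \<tau>"
    and s: "\<And>\<tau>. \<tau> \<in> {0..1} \<Longrightarrow> 0 \<le> s1 \<tau>" "\<And>\<tau>. \<tau> \<in> {0..1} \<Longrightarrow> 0 \<le> s2 \<tau>"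
      "\<And>\<tau>. \<tau> \<in> {0..1} \<Longrightarrow> 0 \<le> s3 \<tau>"
    and l: "\<And>\<tau>. \<tau> \<in> {0..1} \<Longrightarrow> 0 < e \<tau> - b \<tau> + s1 \<tau> + s2 \<tau> + s3 \<tau>"
    and v: "\<And>\<tau>. \<tau> \<in> {0..1} \<Longrightarrow> cis (w \<tau>) * (disp B (b \<tau>) (e \<tau>) + of_real (s1 \<tau>) * cis (B (p1 \<tau>)) +
       of_real (s2 \<tau>) * cis (B (p2 \<tau>)) + of_real (s3 \<tau>) * cis (B (p3 \<tau>))) = cx (y - x)"
  shows "(window x (w 0) B (b 0) (e 0) (p1 0) (s1 0) (p2 0) (s2 0) (p3 0) (s3 0),
          window x (w 1) B (b 1) (e 1) (p1 1) (s1 1) (p2 1) (s2 1) (p3 1) (s3 1)) \<in> constrained_homotopic \<kappa> x y"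
  unfolding window_def
proof (rule angle_curve_family_homotopic[where
      L = "\<lambda>\<tau>. e \<tau> - b \<tau> + s1 \<tau> + s2 \<tau> + s3 \<tau>" and
      \<Theta> = "\<lambda>\<tau> u. w \<tau> + stalled B (p1 \<tau>) (s1 \<tau>) (p2 \<tau>) (s2 \<tau>) (p3 \<tau>) (s3 \<tau>) (u + b \<tau>)"])
  show "continuous_on {0..1} (\<lambda>\<tau>. e \<tau> - b \<tau> + s1 \<tau> + s2 \<tau> + s3 \<tau>)"
    by (intro continuous_intros c)
  have cf: "continuous_on ({0..1} \<times> UNIV) (\<lambda>q::real\<times>real. h (fst q))" if "continuous_on {0..1} h" for h :: "real \<Rightarrow> real"
    by (rule continuous_on_compose2[OF that]) (auto intro!: continuous_intros)
  show "continuous_on ({0..1} \<times> UNIV)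
      (\<lambda>(\<tau>, u). w \<tau> + stalled B (p1 \<tau>) (s1 \<tau>) (p2 \<tau>) (s2 \<tau>) (p3 \<tau>) (s3 \<tau>) (u + b \<tau>))"
    unfolding case_prod_beta' stalled_def stall_def
    by (intro continuous_intros continuous_on_compose2[OF angular_continuous[OF B, of UNIV]] cf c subset_UNIV)
  fix \<tau> :: real assume t: "\<tau> \<in> {0..1}"
  show "angular \<kappa> (\<lambda>u. w \<tau> + stalled B (p1 \<tau>) (s1 \<tau>) (p2 \<tau>) (s2 \<tau>) (p3 \<tau>) (s3 \<tau>) (u + b \<tau>))"
    by (rule angular_shift[OF angular_stalled[OF B s[OF t]]])
  show "disp (\<lambda>u. w \<tau> + stalled B (p1 \<tau>) (s1 \<tau>) (p2 \<tau>) (s2 \<tau>) (p3 \<tau>) (s3 \<tau>) (u + b \<tau>)) 0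
      (e \<tau> - b \<tau> + s1 \<tau> + s2 \<tau> + s3 \<tau>) = cx (y - x)"
    unfolding disp_window[OF angular_continuous[OF B] s[OF t] p[OF t]] by (rule v[OF t])
qed (rule l)

lemma continuous_on_disp:
  assumes "angular \<kappa> B" "continuous_on A b" "continuous_on A e"
  shows "continuous_on A (\<lambda>t. disp B (b t) (e t))"
  unfolding disp_def
  by (intro continuous_intros continuous_on_compose2[OF continuous_on_primitive[OF angular_continuous[OF assms(1)], of UNIV]] assms(2,3) subset_UNIV)

section \<open>Directions that span the plane positively\<close>

definition cross :: "complex \<Rightarrow> complex \<Rightarrow> real" where
  "cross a b = Re a * Im b - Im a * Re b"

text \<open>Cramer's rule for the coordinates of \<open>w\<close> with respect to \<open>a\<close>
  and \<open>b\<close>.\<close>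

lemma cross_decompose:
  assumes "cross a b \<noteq> 0"
  shows "of_real (cross w b / cross a b) * a + of_real (cross a w / cross a b) * b = w"
proof -
  have "cross w b * Re a + cross a w * Re b = cross a b * Re w"
       "cross w b * Im a + cross a w * Im b = cross a b * Im w"
    unfolding cross_def by algebra+
  then show ?thesis using assms
    by (simp add: complex_eq_iff add_divide_distrib[symmetric] divide_eq_eq mult.commute)
qed

text \<open>A triple of directions with \<open>z1 + c z2 + z3 = 0\<close> spans the plane positively, so stalls at the
  three parameters absorb any continuous change of the displacement; adding equal multiples of
  \<open>(1, c, 1)\<close> keeps their lengths nonnegative.\<close>

definition spanning_triple :: "complex \<Rightarrow> real \<Rightarrow> complex \<Rightarrow> complex \<Rightarrow> bool" where
  "spanning_triple z1 c z2 z3 \<longleftrightarrow> 0 \<le> c \<and> z1 + of_real c * z2 + z3 = 0 \<and> cross z1 z3 \<noteq> 0"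

text \<open>The coordinates \<open>a\<close>, \<open>b\<close> may be negative. The multiple
  \<open>\<bar>a\<bar> + \<bar>b\<bar>\<close> of the relation makes every coefficient nonnegative,
  depends continuously on \<open>w\<close> and vanishes at \<open>w = 0\<close>.\<close>

lemma spanning_triple_solution:
  assumes t: "spanning_triple z1 c z2 z3"
    and a: "a = cross w z3 / cross z1 z3" and b: "b = cross z1 w / cross z1 z3"
  shows "0 \<le> \<bar>a\<bar> + \<bar>b\<bar> + a" "0 \<le> c * (\<bar>a\<bar> + \<bar>b\<bar>)" "0 \<le> \<bar>a\<bar> + \<bar>b\<bar> + b"
    "of_real (\<bar>a\<bar> + \<bar>b\<bar> + a) * z1 + of_real (c * (\<bar>a\<bar> + \<bar>b\<bar>)) * z2 + of_real (\<bar>a\<bar> + \<bar>b\<bar> + b) * z3 = w"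
proof -
  show "0 \<le> \<bar>a\<bar> + \<bar>b\<bar> + a" "0 \<le> \<bar>a\<bar> + \<bar>b\<bar> + b" by linarith+
  show "0 \<le> c * (\<bar>a\<bar> + \<bar>b\<bar>)" using t unfolding spanning_triple_def by simp
  have "of_real (\<bar>a\<bar> + \<bar>b\<bar> + a) * z1 + of_real (c * (\<bar>a\<bar> + \<bar>b\<bar>)) * z2 + of_real (\<bar>a\<bar> + \<bar>b\<bar> + b) * z3
    = of_real (\<bar>a\<bar> + \<bar>b\<bar>) * (z1 + of_real c * z2 + z3) + (of_real a * z1 + of_real b * z3)"
    by (simp add: algebra_simps)
  also have "\<dots> = w" using t cross_decompose[of z1 z3 w] unfolding a b spanning_triple_def by simp
  finally show "of_real (\<bar>a\<bar> + \<bar>b\<bar> + a) * z1 + of_real (c * (\<bar>a\<bar> + \<bar>b\<bar>)) * z2 + of_real (\<bar>a\<bar> + \<bar>b\<bar> + b) * z3 = w" .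
qed

text \<open>The stall lengths are interpolated linearly between the prescribed ones, and the
  spanning triple absorbs the remaining error \<open>E\<close> of the displacement. As
  \<open>E\<close> vanishes at both ends, so does the correction, and the prescribed lengths are
  attained.\<close>

lemma compensated_homotopic:
  fixes w b e :: "real \<Rightarrow> real"
  assumes B: "angular \<kappa> B" and p: "p1 \<le> p2" "p2 \<le> p3"
    and t: "spanning_triple (cis (B p1)) c (cis (B p2)) (cis (B p3))"
    and c: "continuous_on {0..1} w" "continuous_on {0..1} b" "continuous_on {0..1} e"
    and pb: "\<And>\<tau>. \<tau> \<in> {0..1} \<Longrightarrow> b \<tau> \<le> p1" and pe: "\<And>\<tau>. \<tau> \<in> {0..1} \<Longrightarrow> p3 \<le> e \<tau>"
    and s: "0 \<le> s1" "0 \<le> s2" "0 \<le> s3" and s': "0 \<le> s1'" "0 \<le> s2'" "0 \<le> s3'"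
    and v: "disp B (b 0) (e 0) + of_real s1 * cis (B p1) + of_real s2 * cis (B p2) + of_real s3 * cis (B p3) = cis (- w 0) * cx (y - x)"
    and v': "disp B (b 1) (e 1) + of_real s1' * cis (B p1) + of_real s2' * cis (B p2) + of_real s3' * cis (B p3) = cis (- w 1) * cx (y - x)"
  shows "(window x (w 0) B (b 0) (e 0) p1 s1 p2 s2 p3 s3, window x (w 1) B (b 1) (e 1) p1 s1' p2 s2' p3 s3') \<in> constrained_homotopic \<kappa> x y"
proof -
  define z1 z2 z3 where z: "z1 = cis (B p1)" "z2 = cis (B p2)" "z3 = cis (B p3)"
  define E where "E \<tau> = cis (- w \<tau>) * cx (y - x) - disp B (b \<tau>) (e \<tau>)
    - of_real (1 - \<tau>) * (of_real s1 * z1 + of_real s2 * z2 + of_real s3 * z3)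
    - of_real \<tau> * (of_real s1' * z1 + of_real s2' * z2 + of_real s3' * z3)" for \<tau> :: real
  have E01: "E 0 = 0" "E 1 = 0"
    using v v' unfolding E_def z by (simp_all add: algebra_simps)
  have cE: "continuous_on {0..1} E"
    unfolding E_def by (intro continuous_intros continuous_on_disp[OF B] c)
  define \<alpha> \<beta> where ab: "\<alpha> \<tau> = cross (E \<tau>) z3 / cross z1 z3" "\<beta> \<tau> = cross z1 (E \<tau>) / cross z1 z3" for \<tau>
  have cab: "continuous_on {0..1} \<alpha>" "continuous_on {0..1} \<beta>"
    using t unfolding ab cross_def spanning_triple_def z[symmetric] by (auto intro!: continuous_intros cE)
  define S1 where "S1 \<tau> = (1 - \<tau>) * s1 + \<tau> * s1' + (\<bar>\<alpha> \<tau>\<bar> + \<bar>\<beta> \<tau>\<bar> + \<alpha> \<tau>)" for \<tau>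
  define S2 where "S2 \<tau> = (1 - \<tau>) * s2 + \<tau> * s2' + c * (\<bar>\<alpha> \<tau>\<bar> + \<bar>\<beta> \<tau>\<bar>)" for \<tau>
  define S3 where "S3 \<tau> = (1 - \<tau>) * s3 + \<tau> * s3' + (\<bar>\<alpha> \<tau>\<bar> + \<bar>\<beta> \<tau>\<bar> + \<beta> \<tau>)" for \<tau>
  note sol = spanning_triple_solution[OF t[folded z] ab]
  have ab0: "\<alpha> 0 = 0" "\<beta> 0 = 0" "\<alpha> 1 = 0" "\<beta> 1 = 0" unfolding ab E01 by (simp_all add: cross_def)
  \<comment> \<open>Every window contains \<open>p1\<close> and \<open>p3\<close>, so their being
    distinct keeps the length positive.\<close>
  have p13: "p1 < p3"
  proof (rule ccontr)
    assume "\<not> p1 < p3"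
    then have "p1 = p3" using p by simp
    then show False using t unfolding spanning_triple_def cross_def by simp
  qed
  have nonneg: "0 \<le> S1 \<tau>" "0 \<le> S2 \<tau>" "0 \<le> S3 \<tau>" if "\<tau> \<in> {0..1}" for \<tau>
    unfolding S1_def S2_def S3_def using sol[of \<tau>] s s' that by (auto intro!: add_nonneg_nonneg)
  have "(window x (w 0) B (b 0) (e 0) p1 (S1 0) p2 (S2 0) p3 (S3 0),
          window x (w 1) B (b 1) (e 1) p1 (S1 1) p2 (S2 1) p3 (S3 1)) \<in> constrained_homotopic \<kappa> x y"
  proof (rule window_homotopic[OF B c, where ?p1.0 = "\<lambda>_. p1" and ?p2.0 = "\<lambda>_. p2" and ?p3.0 = "\<lambda>_. p3"])
    show "continuous_on {0..1} S1" "continuous_on {0..1} S2" "continuous_on {0..1} S3"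
      unfolding S1_def S2_def S3_def by (intro continuous_intros cab)+
    fix \<tau> :: real assume \<tau>: "\<tau> \<in> {0..1}"
    show "0 < e \<tau> - b \<tau> + S1 \<tau> + S2 \<tau> + S3 \<tau>"
      using nonneg[OF \<tau>] pb[OF \<tau>] pe[OF \<tau>] p13 by linarith
    have "disp B (b \<tau>) (e \<tau>) + of_real (S1 \<tau>) * z1 + of_real (S2 \<tau>) * z2 + of_real (S3 \<tau>) * z3
      = disp B (b \<tau>) (e \<tau>)
        + of_real (1 - \<tau>) * (of_real s1 * z1 + of_real s2 * z2 + of_real s3 * z3)
        + of_real \<tau> * (of_real s1' * z1 + of_real s2' * z2 + of_real s3' * z3)
        + (of_real (\<bar>\<alpha> \<tau>\<bar> + \<bar>\<beta> \<tau>\<bar> + \<alpha> \<tau>) * z1 + of_real (c * (\<bar>\<alpha> \<tau>\<bar> + \<bar>\<beta> \<tau>\<bar>)) * z2 + of_real (\<bar>\<alpha> \<tau>\<bar> + \<bar>\<beta> \<tau>\<bar> + \<beta> \<tau>) * z3)"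
      unfolding S1_def S2_def S3_def by (simp add: algebra_simps)
    also have "\<dots> = cis (- w \<tau>) * cx (y - x)"
      unfolding sol(4) E_def by (simp add: algebra_simps)
    finally have "cis (w \<tau>) * (disp B (b \<tau>) (e \<tau>) + of_real (S1 \<tau>) * z1 + of_real (S2 \<tau>) * z2 + of_real (S3 \<tau>) * z3)
       = cis (w \<tau>) * (cis (- w \<tau>) * cx (y - x))" by simp
    then show "cis (w \<tau>) * (disp B (b \<tau>) (e \<tau>) + of_real (S1 \<tau>) * cis (B p1) + of_real (S2 \<tau>) * cis (B p2) + of_real (S3 \<tau>) * cis (B p3)) = cx (y - x)"
      unfolding z by (simp add: mult.assoc[symmetric] cis_mult)
  qed (use nonneg p pb pe in auto)
  then show ?thesis unfolding S1_def S2_def S3_def ab0 by simp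
qed

section \<open>Wide curves form a single class\<close>

text \<open>The parameters \<open>s\<close> and \<open>t\<close> may come in either order, so left
  and right turns are both covered. Strictness excludes the semicircle, whose directions fill only a
  closed half plane.\<close>

definition wide :: "(real \<Rightarrow> real) \<Rightarrow> real \<Rightarrow> bool" where
  "wide f L \<longleftrightarrow> (\<exists>s\<in>{0..L}. \<exists>t\<in>{0..L}. pi < f t - f s)"

lemma spanning_triple_sym: "spanning_triple z1 c z2 z3 \<Longrightarrow> spanning_triple z3 c z2 z1"
  unfolding spanning_triple_def cross_def by (auto simp: algebra_simps)

text \<open>The sum of two unit vectors at angle \<open>\<delta>\<close> is
  \<open>2 cos (\<delta> / 2)\<close> times the vector at the middle angle, and this factor is
  negative just beyond \<open>pi\<close>. The bound \<open>3 * pi / 2\<close> is a choice below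
  \<open>2 * pi\<close>, where the cross product \<open>sin \<delta>\<close> would vanish.\<close>

lemma spanning_triple_cis:
  assumes d: "pi < \<delta>" "\<delta> \<le> 3 * pi / 2"
  shows "spanning_triple (cis a) (- 2 * cos (\<delta> / 2)) (cis (a + \<delta> / 2)) (cis (a + \<delta>))"
  unfolding spanning_triple_def
proof (intro conjI)
  have "0 \<le> cos (pi - \<delta> / 2)" by (rule cos_ge_zero) (use d in auto)
  then show "0 \<le> - 2 * cos (\<delta> / 2)" by simp
  have "cis a + cis (a + \<delta>) = cis (a + \<delta> / 2) * (cis (- (\<delta> / 2)) + cis (\<delta> / 2))"
    by (simp add: distrib_left cis_mult add.commute)
  also have "cis (- (\<delta> / 2)) + cis (\<delta> / 2) = of_real (2 * cos (\<delta> / 2))"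
    by (simp add: complex_eq_iff)
  finally show "cis a + of_real (- 2 * cos (\<delta> / 2)) * cis (a + \<delta> / 2) + cis (a + \<delta>) = 0"
    by (simp add: algebra_simps)
  have "cross (cis a) (cis (a + \<delta>)) = sin (a + \<delta> - a)"
    unfolding cross_def sin_diff[of "a + \<delta>" a] by simp
  moreover have "0 < sin (\<delta> - pi)" by (rule sin_gt_zero) (use d in auto)
  ultimately show "cross (cis a) (cis (a + \<delta>)) \<noteq> 0" by simp
qed

lemma wide_imp_spanning_triple:
  assumes f: "continuous_on UNIV f" and w: "wide f L"
  shows "\<exists>p1 p2 p3 c. 0 \<le> p1 \<and> p1 \<le> p2 \<and> p2 \<le> p3 \<and> p3 \<le> L \<and>
    spanning_triple (cis (f p1)) c (cis (f p2)) (cis (f p3))"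
proof -
  obtain s t where st: "s \<in> {0..L}" "t \<in> {0..L}" "pi < f t - f s"
    using w unfolding wide_def by blast
  \<comment> \<open>A larger range is cut down, since outer directions a full turn apart would be
    parallel.\<close>
  define \<delta> where "\<delta> = min (f t - f s) (3 * pi / 2)"
  have d: "pi < \<delta>" "\<delta> \<le> 3 * pi / 2" "\<delta> \<le> f t - f s"
    using st(3) pi_gt_zero unfolding \<delta>_def by (auto simp: min_def)
  have c: "continuous_on A f" for A using continuous_on_subset[OF f] by blast
  note T = spanning_triple_cis[OF d(1,2), of "f s"]
  show ?thesis
  proof (cases "s \<le> t")
    case True
    obtain t' where t': "s \<le> t'" "t' \<le> t" "f t' = f s + \<delta>"
      using IVT'[of f s "f s + \<delta>" t] c True d pi_gt_zero by auto
    obtain m where m: "s \<le> m" "m \<le> t'" "f m = f s + \<delta> / 2"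
      using IVT'[of f s "f s + \<delta> / 2" t'] c t' d pi_gt_zero by auto
    show ?thesis
      by (rule exI[of _ s], rule exI[of _ m], rule exI[of _ t'], rule exI[of _ "- 2 * cos (\<delta> / 2)"])
        (use t' m st T in auto)
  next
    case False
    obtain t' where t': "t \<le> t'" "t' \<le> s" "f t' = f s + \<delta>"
      using IVT2'[of f s "f s + \<delta>" t] c False d pi_gt_zero by auto
    obtain m where m: "t' \<le> m" "m \<le> s" "f m = f s + \<delta> / 2"
      using IVT2'[of f s "f s + \<delta> / 2" t'] c t' d pi_gt_zero by auto
    show ?thesis
      by (rule exI[of _ t'], rule exI[of _ m], rule exI[of _ s], rule exI[of _ "- 2 * cos (\<delta> / 2)"])
        (use t' m st spanning_triple_sym[OF T] in auto)
  qed
qed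

lemma spanning_triple_nonneg_combination:
  assumes "spanning_triple z1 c z2 z3"
  obtains s1 s2 s3 :: real where "0 \<le> s1" "0 \<le> s2" "0 \<le> s3"
    "of_real s1 * z1 + of_real s2 * z2 + of_real s3 * z3 = w"
  using spanning_triple_solution[OF assms refl refl, of w] by blast

lemma stall_shift: "stall (p + m) s (t + m) = stall p s t + m"
  by (simp add: stall_def min_def max_def)

lemma stall_nonneg: "0 \<le> p \<Longrightarrow> 0 \<le> s \<Longrightarrow> 0 \<le> t \<Longrightarrow> 0 \<le> stall p s t"
  by (simp add: stall_def)

text \<open>Appending a full circle makes the original part dispensable: it is retracted from the
  start while stalls on the circle keep the end points fixed, and the circle is then rotated to a
  standard position.\<close>

lemma wide_homotopic_standard:
  assumes k: "0 < \<kappa>"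
  shows "\<exists>c0\<in>constrained_curves \<kappa> x y. 2 * pi / \<kappa> \<le> fst c0 \<and>
    (\<forall>f L. angular \<kappa> f \<longrightarrow> 0 < L \<longrightarrow> disp f 0 L = cx (y - x) \<longrightarrow> wide f L \<longrightarrow>
      (angle_curve x L f, c0) \<in> constrained_homotopic \<kappa> x y)"
proof -
  define Bs where "Bs t = \<kappa> * t" for t
  define l where "l = 2 * pi / \<kappa>"
  \<comment> \<open>A third of the circumference: the tangents at \<open>0\<close>,
    \<open>q\<close>, \<open>2 * q\<close> are \<open>2 * pi / 3\<close> apart, so the triple is the
    symmetric one and \<open>c\<close> has the value 1.\<close>
  define q where "q = l / 3"
  have l: "0 < l" and kq: "\<kappa> * q = 2 * pi / 3" using k unfolding l_def q_def by auto
  have q: "0 < q" "3 * q = l" using l unfolding q_def by auto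
  define c where "c = - 2 * cos (2 * pi / 3)"
  have Bs: "angular \<kappa> Bs" unfolding Bs_def using angular_affine[of \<kappa> \<kappa> 0] k by simp
  have T: "spanning_triple (cis a) c (cis (a + \<kappa> * q)) (cis (a + \<kappa> * (2 * q)))" for a
  proof -
    have "\<kappa> * (2 * q) = 4 * pi / 3" using kq by simp
    then show ?thesis
      using spanning_triple_cis[of "4 * pi / 3" a] unfolding c_def kq \<open>\<kappa> * (2 * q) = 4 * pi / 3\<close> by simp
  qed
  obtain S1 S2 S3 :: real where S: "0 \<le> S1" "0 \<le> S2" "0 \<le> S3"
    and sS: "of_real S1 * cis 0 + of_real S2 * cis (0 + \<kappa> * q) + of_real S3 * cis (0 + \<kappa> * (2 * q))
      = cx (y - x) - disp Bs 0 l"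
    using spanning_triple_nonneg_combination[OF T] by blast
  define c0 where "c0 = window x 0 Bs 0 l 0 S1 q S2 (2 * q) S3"
  have "c0 \<in> constrained_curves \<kappa> x y"
    unfolding c0_def window_def
  proof (rule angle_curve_in_constrained_curves[OF angular_shift[OF angular_stalled[OF Bs S]]])
    have "disp Bs 0 l + of_real S1 * cis (Bs 0) + of_real S2 * cis (Bs q) + of_real S3 * cis (Bs (2 * q)) = cx (y - x)"
      using sS unfolding Bs_def by (simp add: algebra_simps)
    then show "disp (\<lambda>u. 0 + stalled Bs 0 S1 q S2 (2 * q) S3 (u + 0)) 0 (l - 0 + S1 + S2 + S3) = cx (y - x)"
      using disp_window[OF angular_continuous[OF Bs] S, of 0 0 q "2 * q" l 0] q by simp
  qed (use l S in simp)
  moreover have "2 * pi / \<kappa> \<le> fst c0" unfolding c0_def window_def using S unfolding l_def by simp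
  moreover have "(angle_curve x L f, c0) \<in> constrained_homotopic \<kappa> x y"
    if f: "angular \<kappa> f" and L: "0 < L" and d: "disp f 0 L = cx (y - x)" and w: "wide f L" for f L
  proof -
    \<comment> \<open>The angle \<open>f\<close> continued by a circle of curvature
      \<open>\<kappa>\<close> after \<open>L\<close>.\<close>
    define B1 where "B1 t = (if t \<le> L then f t else (f L - \<kappa> * L) + \<kappa> * t)" for t
    have B1: "angular \<kappa> B1" unfolding B1_def
      by (rule angular_glue[OF f angular_affine]) (use k in auto)
    have B1f: "B1 t = f t" if "t \<le> L" for t using that by (simp add: B1_def)
    obtain p1 p2 p3 c' where p: "0 \<le> p1" "p1 \<le> p2" "p2 \<le> p3" "p3 \<le> L"
      and t0: "spanning_triple (cis (f p1)) c' (cis (f p2)) (cis (f p3))"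
      using wide_imp_spanning_triple[OF angular_continuous[OF f] w] by blast
    have t1: "spanning_triple (cis (B1 p1)) c' (cis (B1 p2)) (cis (B1 p3))"
      using t0 p by (simp add: B1f)
    obtain s1 s2 s3 where s: "0 \<le> s1" "0 \<le> s2" "0 \<le> s3"
      and ss: "of_real s1 * cis (B1 p1) + of_real s2 * cis (B1 p2) + of_real s3 * cis (B1 p3)
        = cx (y - x) - disp B1 0 (L + l)"
      using spanning_triple_nonneg_combination[OF t1] by blast
    have dB1: "disp B1 0 L = cx (y - x)"
      using disp_cong[OF angular_continuous[OF B1] angular_continuous[OF f], of 0 L] L B1f d by simp
    \<comment> \<open>The circle grows at the end of the curve while the triple found on the wide
      part \<open>f\<close> keeps the end point at \<open>y\<close>.\<close>
    have "(window x ((\<lambda>_. 0) 0) B1 ((\<lambda>_. 0) 0) ((\<lambda>\<tau>. L + \<tau> * l) 0) p1 0 p2 0 p3 0,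
        window x ((\<lambda>_. 0) 1) B1 ((\<lambda>_. 0) 1) ((\<lambda>\<tau>. L + \<tau> * l) 1) p1 s1 p2 s2 p3 s3) \<in> constrained_homotopic \<kappa> x y"
    proof (rule compensated_homotopic[OF B1 p(2,3) t1])
      show "disp B1 0 (L + 1 * l) + of_real s1 * cis (B1 p1) + of_real s2 * cis (B1 p2) + of_real s3 * cis (B1 p3)
          = cis (- 0) * cx (y - x)"
        using ss by (simp add: algebra_simps)
      show "p3 \<le> L + \<tau> * l" if "\<tau> \<in> {0..1}" for \<tau>
        using p(4) l that by (simp add: add_increasing2)
    qed (use p s dB1 in \<open>auto intro!: continuous_intros\<close>)
    then have h1: "(window x 0 B1 0 L p1 0 p2 0 p3 0, window x 0 B1 0 (L + l) p1 s1 p2 s2 p3 s3) \<in> constrained_homotopic \<kappa> x y"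
      by simp
    have e1: "window x 0 B1 0 L p1 0 p2 0 p3 0 = angle_curve x L f"
      using angle_curve_cong[OF angular_continuous[OF B1] angular_continuous[OF f], of L x] B1f
      by (simp add: window_def stalled_def)
    \<comment> \<open>The stalls now become part of the turning function, which leaves all three
      stall positions free for use on the circle; the circle starts at \<open>M\<close>.\<close>
    define B2 where "B2 = stalled B1 p1 s1 p2 s2 p3 s3"
    have B2: "angular \<kappa> B2" unfolding B2_def by (rule angular_stalled[OF B1 s])
    define M where "M = L + s1 + s2 + s3"
    have M: "0 < M" using L s unfolding M_def by linarith
    have e2: "window x 0 B1 0 (L + l) p1 s1 p2 s2 p3 s3 = angle_curve x (M + l) B2"
      unfolding window_def B2_def M_def by (simp add: algebra_simps)
    have e3: "window x 0 B2 0 (M + l) M 0 (M + q) 0 (M + 2 * q) 0 = angle_curve x (M + l) B2"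
      by (simp add: window_def stalled_def)
    have B2M: "B2 (u + M) = f L + \<kappa> * u" if "0 \<le> u" for u
    proof -
      have "stall p1 s1 (u + M) = u + M - s1"
        by (rule stall_above) (use that p s in \<open>auto simp: M_def\<close>)
      moreover have "stall p2 s2 (u + M - s1) = u + M - s1 - s2"
        by (rule stall_above) (use that p s in \<open>auto simp: M_def\<close>)
      moreover have "stall p3 s3 (u + M - s1 - s2) = u + L"
        using stall_above[of s3 p3 "u + M - s1 - s2"] that p s by (simp add: M_def)
      ultimately have "B2 (u + M) = B1 (u + L)" unfolding B2_def stalled_def by simp
      also have "\<dots> = f L + \<kappa> * u" using that by (cases "u = 0") (auto simp: B1_def algebra_simps)
      finally show ?thesis .
    qed
    have B2p: "B2 M = f L + \<kappa> * 0" "B2 (M + q) = f L + \<kappa> * q" "B2 (M + 2 * q) = f L + \<kappa> * (2 * q)"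
      using B2M[of 0] B2M[of q] B2M[of "2 * q"] q by (simp_all add: add.commute)
    have dB2: "disp B2 0 (M + l) = cx (y - x)"
      using disp_stalled[OF angular_continuous[OF B1] s, of 0 p1 p2 p3 "L + l"] p l ss
      unfolding B2_def M_def by (simp add: algebra_simps)
    have dB2M: "disp B2 M (M + l) = cis (f L) * disp Bs 0 l"
    proof -
      have cs: "continuous_on UNIV (\<lambda>t. f L + Bs (t + (- M)))"
        by (rule angular_continuous[OF angular_shift[OF Bs]])
      have "disp B2 M (M + l) = disp (\<lambda>t. f L + Bs (t + (- M))) M (M + l)"
      proof (rule disp_cong[OF angular_continuous[OF B2] cs])
        show "B2 t = f L + Bs (t + - M)" if "t \<in> {M..M + l}" for t
          using B2M[of "t - M"] that by (simp add: Bs_def)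
      qed (use l in simp)
      also have "\<dots> = cis (f L) * disp Bs 0 l"
        using disp_shift[OF angular_continuous[OF Bs], of M "M + l" "f L" "- M"] l by simp
      finally show ?thesis .
    qed
    \<comment> \<open>The roles are exchanged: the start moves from \<open>0\<close> to
      \<open>M\<close>, stalls on the circle compensate, and the rotation by \<open>- f L\<close>
      gives the circle the initial direction of \<open>Bs\<close>.\<close>
    have "(window x ((\<lambda>\<tau>. - \<tau> * f L) 0) B2 ((\<lambda>\<tau>. \<tau> * M) 0) ((\<lambda>_. M + l) 0) M 0 (M + q) 0 (M + 2 * q) 0,
        window x ((\<lambda>\<tau>. - \<tau> * f L) 1) B2 ((\<lambda>\<tau>. \<tau> * M) 1) ((\<lambda>_. M + l) 1) M S1 (M + q) S2 (M + 2 * q) S3) \<in> constrained_homotopic \<kappa> x y"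
    proof (rule compensated_homotopic[OF B2, where c = c])
      show "spanning_triple (cis (B2 M)) c (cis (B2 (M + q))) (cis (B2 (M + 2 * q)))"
        unfolding B2p using T[of "f L"] by simp
      have "disp B2 M (M + l) + of_real S1 * cis (B2 M) + of_real S2 * cis (B2 (M + q)) + of_real S3 * cis (B2 (M + 2 * q))
        = cis (f L) * (disp Bs 0 l + (of_real S1 * cis 0 + of_real S2 * cis (0 + \<kappa> * q) + of_real S3 * cis (0 + \<kappa> * (2 * q))))"
        unfolding dB2M B2p by (simp add: algebra_simps cis_mult)
      also have "\<dots> = cis (f L) * cx (y - x)" unfolding sS by simp
      finally show "disp B2 (1 * M) (M + l) + of_real S1 * cis (B2 M) + of_real S2 * cis (B2 (M + q)) + of_real S3 * cis (B2 (M + 2 * q))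
        = cis (- (- 1 * f L)) * cx (y - x)" by simp
      show "\<tau> * M \<le> M" if "\<tau> \<in> {0..1}" for \<tau> using M that by simp
    qed (use S q l dB2 in \<open>auto intro!: continuous_intros\<close>)
    then have h2: "(angle_curve x (M + l) B2, window x (- f L) B2 M (M + l) M S1 (M + q) S2 (M + 2 * q) S3) \<in> constrained_homotopic \<kappa> x y"
      using e3 by simp
    have e4: "window x (- f L) B2 M (M + l) M S1 (M + q) S2 (M + 2 * q) S3 = c0"
    proof -
      have "angle_curve x (l + S1 + S2 + S3) (\<lambda>u. - f L + stalled B2 M S1 (M + q) S2 (M + 2 * q) S3 (u + M))
        = angle_curve x (l + S1 + S2 + S3) (\<lambda>u. 0 + stalled Bs 0 S1 q S2 (2 * q) S3 (u + 0))"
      proof (rule angle_curve_cong)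
        show "continuous_on UNIV (\<lambda>u. - f L + stalled B2 M S1 (M + q) S2 (M + 2 * q) S3 (u + M))"
          by (rule angular_continuous[OF angular_shift[OF angular_stalled[OF B2 S]]])
        show "continuous_on UNIV (\<lambda>u. 0 + stalled Bs 0 S1 q S2 (2 * q) S3 (u + 0))"
          by (rule angular_continuous[OF angular_shift[OF angular_stalled[OF Bs S]]])
        fix u assume u: "u \<in> {0..l + S1 + S2 + S3}"
        define Q where "Q = stall (2 * q) S3 (stall q S2 (stall 0 S1 u))"
        have Q0: "0 \<le> Q" unfolding Q_def using u q S by (intro stall_nonneg) auto
        have "stalled B2 M S1 (M + q) S2 (M + 2 * q) S3 (u + M) = B2 (Q + M)"
          unfolding stalled_def Q_def
          using stall_shift[of 0 M S1 u] stall_shift[of q M S2 "stall 0 S1 u"]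
            stall_shift[of "2 * q" M S3 "stall q S2 (stall 0 S1 u)"]
          by (simp add: add.commute)
        also have "\<dots> = f L + Bs Q" unfolding Bs_def by (rule B2M[OF Q0])
        finally show "cis (- f L + stalled B2 M S1 (M + q) S2 (M + 2 * q) S3 (u + M))
          = cis (0 + stalled Bs 0 S1 q S2 (2 * q) S3 (u + 0))"
          unfolding stalled_def Q_def by simp
      qed
      then show ?thesis unfolding c0_def window_def by simp
    qed
    show ?thesis
      using h1 h2 equivE[OF equiv_constrained_homotopic[of \<kappa> x y]] transD
      unfolding e1 e2 e4 by metis
  qed
  ultimately show ?thesis by blast
qed

section \<open>Narrow curves of length at least \<open>pi / \<kappa>\<close>\<close>

lemma has_integral_Re_disp:
  assumes "continuous_on UNIV f" "a \<le> b"
  shows "((\<lambda>u. cos (f u - c)) has_integral Re (cis (- c) * disp f a b)) {a..b}"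
proof -
  have "((\<lambda>u. Re (cis (- c) * cis (f u))) has_integral Re (cis (- c) * disp f a b)) {a..b}"
    using has_integral_linear[OF has_integral_mult_right[OF has_integral_disp[OF assms], of "cis (- c)"] bounded_linear_Re]
    by (simp add: o_def)
  moreover have "Re (cis (- c) * cis (f u)) = cos (f u - c)" for u
    by (simp add: cis_mult)
  ultimately show ?thesis by simp
qed

text \<open>Outside the finite set the derivatives are two-sided and inherit the Lipschitz bound. A
  finite exceptional set is what the fundamental theorem of calculus tolerates.\<close>

lemma angular_derivative_bound:
  assumes f: "angular \<kappa> f"
  obtains S D where "finite S" "\<And>t. t \<notin> S \<Longrightarrow> (f has_vector_derivative D t) (at t)"
    "\<And>t. t \<notin> S \<Longrightarrow> \<bar>D t\<bar> \<le> \<kappa>"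
proof -
  obtain S where S: "finite S" "\<And>a b. a < b \<Longrightarrow> {a<..<b} \<inter> S = {} \<Longrightarrow> C1_on f a b"
    using f unfolding angular_def pw_C1_def by blast
  have "\<exists>D. (f has_vector_derivative D) (at t) \<and> \<bar>D\<bar> \<le> \<kappa>" if t: "t \<notin> S" for t
  proof -
    have "open (- S)" using finite_imp_closed[OF S(1)] by (rule open_Compl)
    then obtain e where e: "e > 0" "ball t e \<subseteq> - S"
      by (rule openE[where x = t]) (use t in auto)
    have "C1_on f (t - e) (t + e)"
    proof (rule S(2))
      have "{t - e<..<t + e} \<subseteq> ball t e" by (auto simp: dist_real_def)
      then show "{t - e<..<t + e} \<inter> S = {}" using e(2) by blast
    qed (use e in simp)
    then obtain D where D: "(f has_vector_derivative D) (at t within {t - e..t + e})"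
      unfolding C1_on_def using e(1) by (metis atLeastAtMost_iff add_increasing2 diff_le_eq less_imp_le order_refl)
    have "norm D \<le> \<kappa>"
      by (rule norm_derivative_le_lipschitz[OF _ _ D]) (use e angularD[OF f] in auto)
    moreover have "(f has_vector_derivative D) (at t)"
      using D at_within_interior[of t "{t - e..t + e}"] e(1) by simp
    ultimately show ?thesis by auto
  qed
  then obtain D where "\<And>t. t \<notin> S \<Longrightarrow> (f has_vector_derivative D t) (at t) \<and> \<bar>D t\<bar> \<le> \<kappa>"
    by metis
  then show ?thesis using that[OF S(1), of D] by simp
qed

text \<open>With \<open>b = pi / 2 - a\<close> and the factor \<open>2 / \<kappa>\<close>, the right
  side is the projection of an arc of angle \<open>2 * a\<close> plus that of the remaining length
  \<open>(pi - 2 * a) / \<kappa>\<close> at rate \<open>cos a\<close>. The semicircle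
  \<open>a = pi / 2\<close> minimises it.\<close>

lemma cos_add_mult_sin_ge_1:
  fixes b :: real
  assumes "0 \<le> b" "b \<le> pi / 2"
  shows "1 \<le> cos b + b * sin b"
proof -
  have "cos 0 + 0 * sin 0 \<le> cos b + b * sin b"
  proof (rule DERIV_nonneg_imp_nondecreasing[OF assms(1)])
    fix u assume u: "0 \<le> u" "u \<le> b"
    have "((\<lambda>b. cos b + b * sin b) has_real_derivative u * cos u) (at u)"
      by (auto intro!: derivative_eq_intros)
    moreover have "0 \<le> u * cos u"
      using u assms cos_ge_zero[of u] by simp
    ultimately show "\<exists>y. ((\<lambda>b. cos b + b * sin b) has_real_derivative y) (at u) \<and> 0 \<le> y" by blast
  qed
  then show ?thesis by simp
qed

text \<open>If the angle range is \<open>2 a \<le> pi\<close>, project onto the middle direction. The curve must turn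
  from one extreme angle to the other, and doing so at curvature at most \<open>\<kappa>\<close> it gains at least
  the projection of a circular arc.\<close>

lemma narrow_disp_ge:
  assumes f: "angular \<kappa> f" and k: "0 < \<kappa>" and L: "pi / \<kappa> \<le> L" and n: "\<not> wide f L"
  shows "2 / \<kappa> \<le> norm (disp f 0 L)"
proof -
  have L0: "0 < L" using k L pi_gt_zero by (meson divide_pos_pos less_le_trans)
  have cf: "continuous_on A f" for A by (rule angular_continuous[OF f])
  have ne: "compact {0..L}" "{0..L} \<noteq> {}" using L0 by auto
  obtain s where s: "s \<in> {0..L}" "\<And>u. u \<in> {0..L} \<Longrightarrow> f s \<le> f u"
    using continuous_attains_inf[OF ne cf] by blast
  obtain t where t: "t \<in> {0..L}" "\<And>u. u \<in> {0..L} \<Longrightarrow> f u \<le> f t"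
    using continuous_attains_sup[OF ne cf] by blast
  define a where "a = (f t - f s) / 2"
  define c where "c = (f t + f s) / 2"
  define h where "h u = f u - c" for u
  have a: "0 \<le> a" "a \<le> pi / 2"
    using n s(1) t(1) s(2)[OF t(1)] unfolding a_def wide_def by force+
  have hs: "h s = - a" and ht: "h t = a" unfolding h_def a_def c_def by (simp_all add: field_simps)
  have hb: "\<bar>h u\<bar> \<le> a" if "u \<in> {0..L}" for u
    using s(2)[OF that] t(2)[OF that] unfolding h_def a_def c_def by (simp add: abs_le_iff field_simps)
  have g0: "0 \<le> cos (h u) - cos a" if "u \<in> {0..L}" for u
    using cos_monotone_0_pi_le[of "\<bar>h u\<bar>" a] hb[OF that] a pi_gt_zero by simp
  obtain S D where S: "finite S" and D: "\<And>u. u \<notin> S \<Longrightarrow> (f has_vector_derivative D u) (at u)"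
    "\<And>u. u \<notin> S \<Longrightarrow> \<bar>D u\<bar> \<le> \<kappa>"
    using angular_derivative_bound[OF f] by blast
  \<comment> \<open>The default \<open>0\<close> on the exceptional set makes the bound by
    \<open>\<kappa>\<close> hold everywhere.\<close>
  define D' where "D' u = (if u \<in> S then 0 else D u)" for u
  have D': "\<bar>D' u\<bar> \<le> \<kappa>" for u using D(2)[of u] k unfolding D'_def by auto
  have dh: "(h has_real_derivative D' u) (at u)" if "u \<notin> S" for u
    unfolding h_def has_real_derivative_iff_has_vector_derivative
    using has_vector_derivative_diff[OF D(1)[OF that] has_vector_derivative_const[of c]] that by (simp add: D'_def)
  \<comment> \<open>The rate along the middle direction is \<open>cos (h u)\<close>, never below
    \<open>cos a\<close>, and \<open>G\<close> is an antiderivative of the excess with respect to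
    the angle. Its change between the extremes, \<open>2 sin a - 2 a cos a\<close>, is
    \<open>\<kappa>\<close> times the excess of an arc at full curvature.\<close>
  define G where "G \<theta> = sin \<theta> - \<theta> * cos a" for \<theta>
  have ch: "continuous_on A h" for A unfolding h_def by (intro continuous_intros cf)
  have ig: "(\<lambda>u. cos (h u) - cos a) integrable_on {p..q}" for p q
    by (intro integrable_continuous_real continuous_intros ch)
  have GI: "((\<lambda>u. (cos (h u) - cos a) * D' u) has_integral (G (h q) - G (h p))) {p..q}" if "p \<le> q" for p q
  proof (rule fundamental_theorem_of_calculus_interior_strong[OF S that])
    fix u assume u: "u \<in> {p<..<q} - S"
    then have "(h has_real_derivative D' u) (at u)" by (intro dh) simp
    then have "((\<lambda>u. G (h u)) has_real_derivative (cos (h u) - cos a) * D' u) (at u)"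
      unfolding G_def by - (rule derivative_eq_intros refl | assumption | simp add: algebra_simps)+
    then show "((\<lambda>u. G (h u)) has_vector_derivative (cos (h u) - cos a) * D' u) (at u)"
      by (simp add: has_real_derivative_iff_has_vector_derivative)
  next
    show "continuous_on {p..q} (\<lambda>u. G (h u))" unfolding G_def by (intro continuous_intros ch)
  qed
  have bound: "\<bar>G (h q) - G (h p)\<bar> \<le> \<kappa> * integral {0..L} (\<lambda>u. cos (h u) - cos a)"
    if pq: "p \<le> q" "0 \<le> p" "q \<le> L" for p q
  proof -
    have "norm (G (h q) - G (h p)) \<le> integral {p..q} (\<lambda>u. \<kappa> * (cos (h u) - cos a))"
      unfolding integral_unique[OF GI[OF pq(1)], symmetric]
    proof (rule Henstock_Kurzweil_Integration.integral_norm_bound_integral)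
      show "(\<lambda>u. (cos (h u) - cos a) * D' u) integrable_on {p..q}" using GI[OF pq(1)] by blast
      show "(\<lambda>u. \<kappa> * (cos (h u) - cos a)) integrable_on {p..q}"
        by (intro integrable_continuous_real continuous_intros ch)
      fix u assume "u \<in> {p..q}"
      then have "0 \<le> cos (h u) - cos a" using g0 pq by auto
      then show "norm ((cos (h u) - cos a) * D' u) \<le> \<kappa> * (cos (h u) - cos a)"
        using mult_right_mono[OF D'[of u], of "cos (h u) - cos a"] by (simp add: abs_mult mult.commute)
    qed
    also have "\<dots> = \<kappa> * integral {p..q} (\<lambda>u. cos (h u) - cos a)" by simp
    also have "\<dots> \<le> \<kappa> * integral {0..L} (\<lambda>u. cos (h u) - cos a)"
      by (intro mult_left_mono integral_subset_le ig) (use pq g0 k in auto)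
    finally show ?thesis by simp
  qed
  have "2 * sin a - 2 * a * cos a \<le> \<bar>G (h t) - G (h s)\<bar>"
    unfolding hs ht G_def by simp
  also have "\<dots> \<le> \<kappa> * integral {0..L} (\<lambda>u. cos (h u) - cos a)"
    using bound[of s t] bound[of t s] s(1) t(1) by (cases "s \<le> t") (auto simp: abs_minus_commute)
  also have "integral {0..L} (\<lambda>u. cos (h u) - cos a) = Re (cis (- c) * disp f 0 L) - L * cos a"
  proof -
    have "((\<lambda>u. cos (h u) - cos a) has_integral (Re (cis (- c) * disp f 0 L) - L * cos a)) {0..L}"
      using has_integral_diff[OF has_integral_Re_disp[OF cf, of 0 L c] has_integral_const_real[of "cos a" 0 L]] L0
      unfolding h_def by simp
    then show ?thesis by (rule integral_unique)
  qed
  finally have 1: "2 * sin a - 2 * a * cos a \<le> \<kappa> * Re (cis (- c) * disp f 0 L) - \<kappa> * L * cos a"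
    by (simp add: algebra_simps)
  have "pi \<le> \<kappa> * L" using L k by (simp add: pos_divide_le_eq mult.commute)
  moreover have "0 \<le> cos a" by (rule cos_ge_zero) (use a in auto)
  ultimately have "pi * cos a \<le> \<kappa> * L * cos a" by (rule mult_right_mono)
  moreover have "1 \<le> sin a + (pi / 2 - a) * cos a"
    using cos_add_mult_sin_ge_1[of "pi / 2 - a"] a by (simp add: cos_diff sin_diff)
  ultimately have "2 \<le> \<kappa> * Re (cis (- c) * disp f 0 L)"
    using 1 by (simp add: algebra_simps)
  also have "\<dots> \<le> \<kappa> * norm (disp f 0 L)"
    using complex_Re_le_cmod[of "cis (- c) * disp f 0 L"] k by (simp add: norm_mult)
  finally show ?thesis using k by (simp add: pos_divide_le_eq mult.commute)
qed

section \<open>Moving the start of a curve, with one stall and a rotation\<close>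

lemma inner_cis: "w \<bullet> cis c = Re (cis (- c) * w)"
  by (simp add: inner_complex_def)

text \<open>The nonnegative root \<open>s\<close> of \<open>norm (w + s z) = d\<close>.\<close>

definition stall_length :: "real \<Rightarrow> complex \<Rightarrow> complex \<Rightarrow> real" where
  "stall_length d w z = sqrt (d\<^sup>2 - (norm w)\<^sup>2 + (w \<bullet> z)\<^sup>2) - w \<bullet> z"

lemma stall_length:
  assumes "norm w \<le> d" "norm z = 1"
  shows "0 \<le> stall_length d w z" "norm (w + of_real (stall_length d w z) * z) = d"
proof -
  have d: "0 \<le> d" using assms(1) norm_ge_zero order_trans by blast
  have "(norm w)\<^sup>2 \<le> d\<^sup>2" using assms(1) by (simp add: power_mono)
  then have r: "(w \<bullet> z)\<^sup>2 \<le> d\<^sup>2 - (norm w)\<^sup>2 + (w \<bullet> z)\<^sup>2" by simp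
  then have "\<bar>w \<bullet> z\<bar> \<le> sqrt (d\<^sup>2 - (norm w)\<^sup>2 + (w \<bullet> z)\<^sup>2)"
    by (metis real_sqrt_abs real_sqrt_le_iff)
  then show "0 \<le> stall_length d w z" unfolding stall_length_def by linarith
  define s where "s = stall_length d w z"
  have sq: "(s + w \<bullet> z)\<^sup>2 = d\<^sup>2 - (norm w)\<^sup>2 + (w \<bullet> z)\<^sup>2"
    unfolding s_def stall_length_def using order_trans[OF zero_le_power2 r] by simp
  have "(norm (w + of_real s * z))\<^sup>2 = (norm w)\<^sup>2 + 2 * s * (w \<bullet> z) + s\<^sup>2 * (norm z)\<^sup>2"
    unfolding cmod_power2 inner_complex_def by (simp add: power2_eq_square algebra_simps)
  also have "\<dots> = d\<^sup>2" using sq assms(2) by (simp add: power2_eq_square algebra_simps)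
  finally have "(norm (w + of_real s * z))\<^sup>2 = d\<^sup>2" .
  then show "norm (w + of_real (stall_length d w z) * z) = d"
    using d unfolding s_def by (simp add: power2_eq_iff_nonneg)
qed

text \<open>For negative \<open>w \<bullet> z\<close> the formula gives the larger root
  \<open>- 2 (w \<bullet> z)\<close> instead. A deformation that starts without a stall must
  therefore place it in a direction that does not point away from the displacement.\<close>

lemma stall_length_eq_0: "norm w = d \<Longrightarrow> 0 \<le> w \<bullet> z \<Longrightarrow> stall_length d w z = 0"
  by (simp add: stall_length_def)

text \<open>While the displacement of the window \<open>{b..e}\<close> stays at most \<open>d\<close>, one stall brings it back to
  norm \<open>d\<close>, and a continuous choice of rotation brings it back to \<open>y - x\<close>.\<close>

lemma retract_homotopic:
  assumes B: "angular \<kappa> B" and d: "0 < d" "norm (y - x) = d"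
    and p: "b0 \<le> p0" "p0 \<le> e" "b1 \<le> p1" "p1 \<le> e"
    and D: "\<And>\<tau>. \<tau> \<in> {0..1} \<Longrightarrow> norm (disp B ((1 - \<tau>) * b0 + \<tau> * b1) e) \<le> d"
    and S0: "S0 = stall_length d (disp B b0 e) (cis (B p0))"
    and S1: "S1 = stall_length d (disp B b1 e) (cis (B p1))"
    and w0: "cis w0 * (disp B b0 e + of_real S0 * cis (B p0)) = cx (y - x)"
  shows "\<exists>w1. cis w1 * (disp B b1 e + of_real S1 * cis (B p1)) = cx (y - x) \<and>
    (window x w0 B b0 e p0 S0 p0 0 p0 0, window x w1 B b1 e p1 S1 p1 0 p1 0) \<in> constrained_homotopic \<kappa> x y"
proof -
  define b where "b \<tau> = (1 - \<tau>) * b0 + \<tau> * b1" for \<tau>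
  define P where "P \<tau> = (1 - \<tau>) * p0 + \<tau> * p1" for \<tau>
  define s where "s \<tau> = stall_length d (disp B (b \<tau>) e) (cis (B (P \<tau>)))" for \<tau>
  define U where "U \<tau> = disp B (b \<tau>) e + of_real (s \<tau>) * cis (B (P \<tau>))" for \<tau>
  have nD: "norm (disp B (b \<tau>) e) \<le> d" if "\<tau> \<in> {0..1}" for \<tau> unfolding b_def by (rule D[OF that])
  have s: "0 \<le> s \<tau>" and nU: "norm (U \<tau>) = d" if "\<tau> \<in> {0..1}" for \<tau>
    using stall_length[OF nD[OF that], of "cis (B (P \<tau>))"] unfolding U_def s_def by auto
  have cb: "continuous_on {0..1} b" "continuous_on {0..1} P" unfolding b_def P_def by (intro continuous_intros)+
  have cz: "continuous_on {0..1} (\<lambda>\<tau>. cis (B (P \<tau>)))"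
    by (intro continuous_intros continuous_on_compose2[OF angular_continuous[OF B, of UNIV]] cb subset_UNIV)
  have cD: "continuous_on {0..1} (\<lambda>\<tau>. disp B (b \<tau>) e)"
    by (intro continuous_on_disp[OF B] cb continuous_intros)
  have cs: "continuous_on {0..1} s"
    unfolding s_def stall_length_def by (intro continuous_intros cD cz)
  have cU: "continuous_on {0..1} U"
    unfolding U_def by (intro continuous_intros cD cz cs)
  have U0: "U \<tau> \<noteq> 0" if "\<tau> \<in> {0..1}" for \<tau> using nU[OF that] d by auto
  define v where "v = cx (y - x)"
  have nv: "norm v = d" unfolding v_def using d by simp
  have "continuous_on {0..1} (\<lambda>\<tau>. v / U \<tau>)" by (intro continuous_intros cU ballI U0)
  moreover have "contractible {0..1::real}" by (rule convex_imp_contractible) simp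
  moreover have "v / U \<tau> \<noteq> 0" if "\<tau> \<in> {0..1}" for \<tau> using U0[OF that] nv d by auto
  ultimately obtain g where g: "continuous_on {0..1} g" "\<And>\<tau>. \<tau> \<in> {0..1} \<Longrightarrow> v / U \<tau> = exp (g \<tau>)"
    using continuous_logarithm_on_contractible by blast
  have cg: "cis (Im (g \<tau>)) * U \<tau> = v" if "\<tau> \<in> {0..1}" for \<tau>
  proof -
    have "exp (Re (g \<tau>)) = 1"
      using g(2)[OF that] nv nU[OF that] d by (metis divide_self less_irrefl norm_divide norm_exp_eq_Re)
    then have "v / U \<tau> = cis (Im (g \<tau>))" using g(2)[OF that] by (simp add: exp_eq_polar)
    then show ?thesis using U0[OF that] by (metis nonzero_eq_divide_eq)
  qed
  \<comment> \<open>The logarithm determines the rotation only up to a constant multiple of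
    \<open>2 * pi\<close>; it is adjusted to start exactly at \<open>w0\<close>.\<close>
  define w where "w \<tau> = Im (g \<tau>) - Im (g 0) + w0" for \<tau>
  have ends: "b 0 = b0" "b 1 = b1" "P 0 = p0" "P 1 = p1" "s 0 = S0" "s 1 = S1"
    unfolding S0 S1 s_def b_def P_def by simp_all
  have "cis w0 * U 0 = cis (Im (g 0)) * U 0"
    using w0 cg[of 0] unfolding U_def ends v_def by simp
  then have c0: "cis w0 = cis (Im (g 0))" using U0[of 0] by simp
  have wU: "cis (w \<tau>) * U \<tau> = v" if "\<tau> \<in> {0..1}" for \<tau>
  proof -
    have "cis (w \<tau>) = cis (Im (g \<tau>)) * (cis (- Im (g 0)) * cis w0)"
      unfolding w_def by (simp add: cis_mult algebra_simps)
    also have "\<dots> = cis (Im (g \<tau>))" unfolding c0 by (simp add: cis_mult)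
    finally show ?thesis using cg[OF that] by simp
  qed
  have "(window x (w 0) B (b 0) e (P 0) (s 0) (P 0) 0 (P 0) 0,
         window x (w 1) B (b 1) e (P 1) (s 1) (P 1) 0 (P 1) 0) \<in> constrained_homotopic \<kappa> x y"
  proof (rule window_homotopic[OF B, where e = "\<lambda>_. e" and ?s2.0 = "\<lambda>_. 0" and ?s3.0 = "\<lambda>_. 0" and ?p2.0 = P and ?p3.0 = P])
    show "continuous_on {0..1} w" unfolding w_def by (intro continuous_intros g(1))
    fix \<tau> :: real assume \<tau>: "\<tau> \<in> {0..1}"
    show bP: "b \<tau> \<le> P \<tau>" unfolding b_def P_def using \<tau> p by (intro add_mono mult_left_mono) auto
    show Pe: "P \<tau> \<le> e" unfolding P_def using \<tau> p by (intro convex_bound_le) auto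
    \<comment> \<open>If the window shrinks to a point, the stall carries the whole displacement and
      has length \<open>d\<close>.\<close>
    show "0 < e - b \<tau> + s \<tau> + 0 + 0"
    proof (cases "b \<tau> = e")
      case True
      then have "U \<tau> = of_real (s \<tau>) * cis (B (P \<tau>))" unfolding U_def by simp
      then have "\<bar>s \<tau>\<bar> = d" using nU[OF \<tau>] by (simp add: norm_mult)
      then show ?thesis using s[OF \<tau>] True d by simp
    next
      case False
      then show ?thesis using bP Pe s[OF \<tau>] by simp
    qed
    show "cis (w \<tau>) * (disp B (b \<tau>) e + of_real (s \<tau>) * cis (B (P \<tau>)) + of_real 0 * cis (B (P \<tau>)) + of_real 0 * cis (B (P \<tau>))) = cx (y - x)"
      using wU[OF \<tau>] unfolding U_def v_def by simp
  qed (use s cb cs in \<open>auto intro!: continuous_intros\<close>)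
  moreover have "w 0 = w0" by (simp add: w_def)
  moreover have "cis (w 1) * (disp B b1 e + of_real S1 * cis (B p1)) = cx (y - x)"
    using wU[of 1] unfolding U_def ends v_def by simp
  ultimately show ?thesis unfolding ends by (intro exI[of _ "w 1"]) simp
qed

text \<open>As the start moves along the curve, the squared distance to the end changes at the rate
  \<open>- 2\<close> times the inner product of the remaining displacement with the tangent.\<close>

lemma norm_disp_antimono:
  assumes f: "continuous_on UNIV f" and b: "b0 \<le> b1"
    and a: "\<And>t. b0 \<le> t \<Longrightarrow> t \<le> b1 \<Longrightarrow> 0 \<le> disp f t e \<bullet> cis (f t)"
  shows "norm (disp f b1 e) \<le> norm (disp f b0 e)"
proof -
  have "(norm (disp f b1 e))\<^sup>2 \<le> (norm (disp f b0 e))\<^sup>2"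
    unfolding cmod_power2
  proof (rule DERIV_nonpos_imp_nonincreasing[OF b])
    fix t assume t: "b0 \<le> t" "t \<le> b1"
    have D: "((\<lambda>t. disp f t e) has_vector_derivative 0 - cis (f t)) (at t)"
      unfolding disp_def by (intro has_vector_derivative_diff primitive_deriv[OF f] has_vector_derivative_const)
    have 1: "((\<lambda>t. Re (disp f t e)) has_real_derivative - cos (f t)) (at t)"
      and 2: "((\<lambda>t. Im (disp f t e)) has_real_derivative - sin (f t)) (at t)"
      using bounded_linear.has_vector_derivative[OF bounded_linear_Re D]
        bounded_linear.has_vector_derivative[OF bounded_linear_Im D]
      by (simp_all add: has_real_derivative_iff_has_vector_derivative)
    have "((\<lambda>t. (Re (disp f t e))\<^sup>2 + (Im (disp f t e))\<^sup>2) has_real_derivative - 2 * (disp f t e \<bullet> cis (f t))) (at t)"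
      using DERIV_add[OF DERIV_power[OF 1, of 2] DERIV_power[OF 2, of 2]]
      by (simp add: inner_complex_def algebra_simps)
    then show "\<exists>y. ((\<lambda>t. (Re (disp f t e))\<^sup>2 + (Im (disp f t e))\<^sup>2) has_real_derivative y) (at t) \<and> y \<le> 0"
      using a[OF t] by (intro exI conjI) auto
  qed
  then show ?thesis by (rule power2_le_imp_le) simp
qed

section \<open>Curves shorter than \<open>pi / \<kappa>\<close>\<close>

text \<open>Comparison with a circle: the tangent at \<open>u\<close> deviates from the one at
  \<open>t\<close> by at most \<open>\<kappa> * (u - t)\<close>, and \<open>cos\<close> decreases on
  \<open>{0..pi}\<close>. Integrating the cosines gives the bound, which a circular arc
  attains.\<close>

lemma short_disp_inner_ge:
  assumes f: "angular \<kappa> f" and k: "0 < \<kappa>" and t: "t \<le> L" "\<kappa> * (L - t) \<le> pi"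
  shows "sin (\<kappa> * (L - t)) / \<kappa> \<le> disp f t L \<bullet> cis (f t)"
proof -
  have "((\<lambda>u. cos (\<kappa> * (u - t))) has_integral (sin (\<kappa> * (L - t)) / \<kappa> - sin (\<kappa> * (t - t)) / \<kappa>)) {t..L}"
  proof (rule fundamental_theorem_of_calculus[OF t(1)])
    fix u
    have "((\<lambda>u. sin (\<kappa> * (u - t)) / \<kappa>) has_real_derivative cos (\<kappa> * (u - t))) (at u within {t..L})"
      using k by (auto intro!: derivative_eq_intros)
    then show "((\<lambda>u. sin (\<kappa> * (u - t)) / \<kappa>) has_vector_derivative cos (\<kappa> * (u - t))) (at u within {t..L})"
      by (simp add: has_real_derivative_iff_has_vector_derivative)
  qed
  then have "((\<lambda>u. cos (\<kappa> * (u - t))) has_integral (sin (\<kappa> * (L - t)) / \<kappa>)) {t..L}" by simp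
  moreover have "((\<lambda>u. cos (f u - f t)) has_integral disp f t L \<bullet> cis (f t)) {t..L}"
    unfolding inner_cis by (rule has_integral_Re_disp[OF angular_continuous[OF f] t(1)])
  ultimately show ?thesis
  proof (rule has_integral_le)
    fix u assume u: "u \<in> {t..L}"
    have "\<bar>f u - f t\<bar> \<le> \<kappa> * (u - t)" using angularD[OF f, of u t] u by simp
    moreover have "\<kappa> * (u - t) \<le> pi"
      by (rule order_trans[OF mult_left_mono t(2)]) (use u k in auto)
    ultimately show "cos (\<kappa> * (u - t)) \<le> cos (f u - f t)"
      using cos_monotone_0_pi_le[of "\<bar>f u - f t\<bar>" "\<kappa> * (u - t)"] by simp
  qed
qed

lemma short_homotopic_segment:
  assumes f: "angular \<kappa> f" and k: "0 < \<kappa>" and L: "0 < L" "\<kappa> * L < pi"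
    and v: "disp f 0 L = cx (y - x)" and xy: "x \<noteq> y"
  shows "(angle_curve x L f, angle_curve x (norm (y - x)) (\<lambda>_. Arg (cx (y - x)))) \<in> constrained_homotopic \<kappa> x y"
proof -
  define d where "d = norm (y - x)"
  have d: "0 < d" "norm (y - x) = d" using xy unfolding d_def by auto
  have a: "0 \<le> disp f t L \<bullet> cis (f t)" if "0 \<le> t" "t \<le> L" for t
  proof -
    have "\<kappa> * (L - t) \<le> \<kappa> * L" using that k by simp
    then have "\<kappa> * (L - t) \<le> pi" using L by linarith
    moreover have "0 \<le> sin (\<kappa> * (L - t)) / \<kappa>"
      using that k calculation by (intro divide_nonneg_pos sin_ge_zero) auto
    ultimately show ?thesis using short_disp_inner_ge[OF f k that(2)] by linarith
  qed
  have nD: "norm (disp f ((1 - \<tau>) * 0 + \<tau> * L) L) \<le> d" if "\<tau> \<in> {0..1}" for \<tau>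
  proof -
    have "\<tau> * L \<le> L" using that L by simp
    then have "0 \<le> disp f t L \<bullet> cis (f t)" if "0 \<le> t" "t \<le> \<tau> * L" for t
      using a that by simp
    then have "norm (disp f (\<tau> * L) L) \<le> norm (disp f 0 L)"
      by (intro norm_disp_antimono angular_continuous[OF f]) (use that L in auto)
    then show ?thesis using v d by simp
  qed
  have S0: "stall_length d (disp f 0 L) (cis (f 0)) = 0"
    by (rule stall_length_eq_0) (use v d a[of 0] L in auto)
  have S1: "stall_length d (disp f L L) (cis (f L)) = d"
    using d by (simp add: stall_length_def)
  \<comment> \<open>The stall travels with the start from \<open>0\<close> to \<open>L\<close>. In
    the end the window is the single point \<open>L\<close>, and only the stall of length
    \<open>d\<close> is left.\<close>
  obtain w1 where w1: "cis w1 * (disp f L L + of_real d * cis (f L)) = cx (y - x)"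
    and h: "(window x 0 f 0 L 0 0 0 0 0 0, window x w1 f L L L d L 0 L 0) \<in> constrained_homotopic \<kappa> x y"
    using retract_homotopic[OF f d, of 0 0 L L L 0 d 0] L nD S0 S1 v by auto
  have "angle_curve x d (\<lambda>u. w1 + stalled f L d L 0 L 0 (u + L)) = angle_curve x d (\<lambda>_. Arg (cx (y - x)))"
  proof (rule angle_curve_cong)
    show "continuous_on UNIV (\<lambda>u. w1 + stalled f L d L 0 L 0 (u + L))"
      by (rule angular_continuous[OF angular_shift[OF angular_stalled[OF f]]]) (use d in auto)
    fix u assume "u \<in> {0..d}"
    then have "stalled f L d L 0 L 0 (u + L) = f L" unfolding stalled_def by (simp add: stall_between)
    moreover have "cis (Arg (cx (y - x))) = cis (w1 + f L)"
    proof -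
      have "cx (y - x) \<noteq> 0" using xy d by (metis norm_cx norm_zero less_irrefl)
      then have "cis (Arg (cx (y - x))) = cx (y - x) /\<^sub>R d" using d by (simp add: cis_Arg sgn_div_norm)
      also have "\<dots> = cis (w1 + f L)"
        using w1 d by (simp add: cis_mult[symmetric] scaleR_conv_of_real field_simps)
      finally show ?thesis .
    qed
    ultimately show "cis (w1 + stalled f L d L 0 L 0 (u + L)) = cis (Arg (cx (y - x)))" by simp
  qed simp
  moreover have "window x 0 f 0 L 0 0 0 0 0 0 = angle_curve x L f"
    by (simp add: window_def stalled_def)
  ultimately show ?thesis using h unfolding window_def d_def by simp
qed

section \<open>End points at distance at least \<open>2 / \<kappa>\<close>\<close>

text \<open>An antiderivative of the tangent is \<open>cis (a + m * (t - t0)) / (\<i> * m)\<close>.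
  The factor \<open>cis a\<close> expresses the result in the frame of the tangent at which the arc
  ends.\<close>

lemma disp_affine:
  assumes m: "m \<noteq> 0" and b: "b \<le> t0"
  shows "disp (\<lambda>t. a + m * (t - t0)) b t0 = cis a * (Complex (sin (m * (t0 - b))) (cos (m * (t0 - b)) - 1) / of_real m)"
proof -
  have "disp (\<lambda>t. a + m * (t - t0)) b t0 = cis (a + m * (t0 - t0)) / (\<i> * of_real m) - cis (a + m * (b - t0)) / (\<i> * of_real m)"
  proof (rule disp_eqI[OF _ b])
    show "continuous_on UNIV (\<lambda>t. a + m * (t - t0))" by (intro continuous_intros)
    fix t
    have l: "((\<lambda>t. a + m * (t - t0)) has_derivative (\<lambda>h. m * h)) (at t within {b..t0})"
      by (auto intro!: derivative_eq_intros)
    have "((\<lambda>t. cis (a + m * (t - t0))) has_vector_derivative m *\<^sub>R (\<i> * cis (a + m * (t - t0)))) (at t within {b..t0})"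
      using has_derivative_cis[OF l] unfolding has_vector_derivative_def by (simp add: mult.commute)
    from has_vector_derivative_mult_left[OF this, of "1 / (\<i> * of_real m)"]
    show "((\<lambda>t. cis (a + m * (t - t0)) / (\<i> * of_real m)) has_vector_derivative cis (a + m * (t - t0))) (at t within {b..t0})"
      using m by (simp add: scaleR_conv_of_real)
  qed
  also have "\<dots> = cis a * ((1 - cis (m * (b - t0))) / (\<i> * of_real m))"
    by (simp add: cis_mult[symmetric] diff_divide_distrib right_diff_distrib)
  also have "(1 - cis (m * (b - t0))) / (\<i> * of_real m) = Complex (sin (m * (t0 - b))) (cos (m * (t0 - b)) - 1) / of_real m"
  proof -
    have "1 - cis (m * (b - t0)) = \<i> * Complex (sin (m * (t0 - b))) (cos (m * (t0 - b)) - 1)"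
      using sin_minus[of "m * (t0 - b)"] cos_minus[of "m * (t0 - b)"]
      by (simp add: complex_eq_iff right_diff_distrib)
    then show ?thesis by simp
  qed
  finally show ?thesis .
qed

text \<open>The left side is the squared distance between a point of a circle of radius
  \<open>r\<close> and a point at distance \<open>\<bar>r - m\<bar>\<close> from its centre. The
  maximum distance \<open>r + \<bar>r - m\<bar>\<close> is \<open>m\<close> or
  \<open>2 * r - m\<close>, and both are at most \<open>d\<close>.\<close>

lemma arc_step_bound:
  fixes m r c s d :: real
  assumes "0 \<le> m" "m \<le> d" "0 < r" "2 * r \<le> d" "-1 \<le> c" "c \<le> 1" "s\<^sup>2 + c\<^sup>2 = 1"
  shows "(r * s)\<^sup>2 + (m - r * (1 - c))\<^sup>2 \<le> d\<^sup>2"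
proof -
  have eq: "(r * s)\<^sup>2 + (m - r * (1 - c))\<^sup>2 = m\<^sup>2 + 2 * r * (1 - c) * (r - m)"
  proof -
    have s2: "s\<^sup>2 = 1 - c\<^sup>2" using assms(7) by linarith
    show ?thesis unfolding power_mult_distrib s2 by (simp add: power2_eq_square algebra_simps)
  qed
  show ?thesis
  proof (cases "r \<le> m")
    case True
    have "2 * r * (1 - c) * (r - m) \<le> 0"
      by (rule mult_nonneg_nonpos) (use True assms in auto)
    moreover have "m\<^sup>2 \<le> d\<^sup>2" using assms by (simp add: power_mono)
    ultimately show ?thesis unfolding eq by linarith
  next
    case False
    have "r * (1 - c) * (r - m) \<le> r * 2 * (r - m)"
      by (intro mult_right_mono mult_left_mono) (use False assms in auto)
    then have "m\<^sup>2 + 2 * r * (1 - c) * (r - m) \<le> m\<^sup>2 + 4 * r * (r - m)" by linarith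
    also have "\<dots> = (2 * r - m)\<^sup>2" by (simp add: power2_eq_square algebra_simps)
    also have "\<dots> \<le> d\<^sup>2" by (rule power_mono) (use False assms in auto)
    finally show ?thesis unfolding eq .
  qed
qed

text \<open>If the displacement of the window is orthogonal to its initial tangent, prepend an arc that
  arrives at the window turning towards the end point. The displacement stays at most \<open>d\<close> because
  \<open>2 / \<kappa> \<le> d\<close>, and after three quarters of a circle the curve is wide.\<close>

lemma prepend_arc_homotopic_wide:
  assumes B: "angular \<kappa> B" and k: "0 < \<kappa>" and d: "2 / \<kappa> \<le> d" "norm (y - x) = d"
    and p: "t0 \<le> p" "p \<le> e"
    and D: "norm (disp B t0 e) \<le> d" and orth: "disp B t0 e \<bullet> cis (B t0) = 0"
    and S: "S = stall_length d (disp B t0 e) (cis (B p))"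
    and w0: "cis w0 * (disp B t0 e + of_real S * cis (B p)) = cx (y - x)"
  shows "\<exists>g L. angular \<kappa> g \<and> 0 < L \<and> disp g 0 L = cx (y - x) \<and> wide g L \<and>
    (window x w0 B t0 e p S p 0 p 0, angle_curve x L g) \<in> constrained_homotopic \<kappa> x y"
proof -
  have d0: "0 < d" using k d(1) by (meson divide_pos_pos less_le_trans zero_less_numeral)
  have cB: "continuous_on A B" for A by (rule angular_continuous[OF B])
  \<comment> \<open>The coordinate of the end point along the left normal of the initial tangent.
    Its sign \<open>\<sigma>\<close> selects the side to which the prepended arc turns.\<close>
  define \<mu> where "\<mu> = Im (cis (- B t0) * disp B t0 e)"
  define \<sigma> where "\<sigma> = (if 0 \<le> \<mu> then 1 else - 1 :: real)"
  define m where "m = \<bar>\<mu>\<bar>"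
  have sm: "\<mu> = \<sigma> * m" "\<bar>\<sigma>\<bar> = 1" "\<sigma> * \<sigma> = 1" "\<sigma> = 1 \<or> \<sigma> = -1" unfolding \<sigma>_def m_def by auto
  have De: "cis (- B t0) * disp B t0 e = Complex 0 (\<sigma> * m)"
    using orth unfolding inner_cis sm(1)[symmetric] \<mu>_def by (simp add: complex_eq_iff)
  have "norm (cis (- B t0) * disp B t0 e) = m"
    unfolding De using sm(2) by (simp add: cmod_def abs_mult m_def)
  then have m: "0 \<le> m" "m \<le> d" using D by (auto simp: norm_mult)
  define C where "C t = (if t \<le> t0 then B t0 + \<sigma> * \<kappa> * (t - t0) else B t)" for t
  have C: "angular \<kappa> C"
  proof -
    have "angular \<kappa> (\<lambda>t. (B t0 - \<sigma> * \<kappa> * t0) + \<sigma> * \<kappa> * t)"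
      by (rule angular_affine) (use k sm(2) in \<open>simp add: abs_mult\<close>)
    then have "angular \<kappa> (\<lambda>t. if t \<le> t0 then (B t0 - \<sigma> * \<kappa> * t0) + \<sigma> * \<kappa> * t else B t)"
      using B by (rule angular_glue) simp
    moreover have "(\<lambda>t. if t \<le> t0 then (B t0 - \<sigma> * \<kappa> * t0) + \<sigma> * \<kappa> * t else B t) = C"
      by (auto simp: C_def fun_eq_iff algebra_simps)
    ultimately show ?thesis by simp
  qed
  have CB: "C t = B t" if "t0 \<le> t" for t using that by (cases "t = t0") (auto simp: C_def)
  have dC: "disp C t0 e = disp B t0 e"
    by (rule disp_cong[OF angular_continuous[OF C] cB]) (use p CB in auto)
  have bound: "norm (disp C b e) \<le> d" if b: "b \<le> t0" for b
  proof -
    have "disp C b t0 = disp (\<lambda>t. B t0 + \<sigma> * \<kappa> * (t - t0)) b t0"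
      by (rule disp_cong[OF angular_continuous[OF C] _ b]) (auto simp: C_def intro!: continuous_intros)
    also have "\<dots> = cis (B t0) * (Complex (sin (\<sigma> * \<kappa> * (t0 - b))) (cos (\<sigma> * \<kappa> * (t0 - b)) - 1) / of_real (\<sigma> * \<kappa>))"
      by (rule disp_affine[OF _ b]) (use k sm(4) in auto)
    finally have "cis (- B t0) * disp C b t0 = Complex (sin (\<sigma> * \<kappa> * (t0 - b))) (cos (\<sigma> * \<kappa> * (t0 - b)) - 1) / of_real (\<sigma> * \<kappa>)"
      by (simp add: mult.assoc[symmetric] cis_mult)
    also have "\<dots> = Complex (1 / \<kappa> * sin (\<kappa> * (t0 - b))) (- \<sigma> * (1 / \<kappa> * (1 - cos (\<kappa> * (t0 - b)))))"
    proof -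
      define u where "u = \<kappa> * (t0 - b)"
      have "\<sigma> * \<kappa> * (t0 - b) = \<sigma> * u" by (simp add: u_def)
      then show ?thesis
        unfolding u_def[symmetric] using sm(4) k by (auto simp: complex_eq_iff field_simps)
    qed
    finally have arc: "cis (- B t0) * disp C b t0 = Complex (1 / \<kappa> * sin (\<kappa> * (t0 - b))) (- \<sigma> * (1 / \<kappa> * (1 - cos (\<kappa> * (t0 - b)))))" .
    have "cis (- B t0) * disp C b e = cis (- B t0) * disp C b t0 + cis (- B t0) * disp B t0 e"
      unfolding dC[symmetric] distrib_left[symmetric] disp_add ..
    also have "\<dots> = Complex (1 / \<kappa> * sin (\<kappa> * (t0 - b))) (\<sigma> * (m - 1 / \<kappa> * (1 - cos (\<kappa> * (t0 - b)))))"
      unfolding arc De by (simp add: complex_eq_iff right_diff_distrib)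
    finally have "cis (- B t0) * disp C b e = Complex (1 / \<kappa> * sin (\<kappa> * (t0 - b))) (\<sigma> * (m - 1 / \<kappa> * (1 - cos (\<kappa> * (t0 - b)))))" .
    then have "norm (disp C b e) = norm (Complex (1 / \<kappa> * sin (\<kappa> * (t0 - b))) (\<sigma> * (m - 1 / \<kappa> * (1 - cos (\<kappa> * (t0 - b))))))"
      by (metis mult_1 norm_cis norm_mult)
    then have "(norm (disp C b e))\<^sup>2 = (1 / \<kappa> * sin (\<kappa> * (t0 - b)))\<^sup>2 + (m - 1 / \<kappa> * (1 - cos (\<kappa> * (t0 - b))))\<^sup>2"
      using sm(4) by (auto simp: cmod_power2 power2_commute)
    also have "\<dots> \<le> d\<^sup>2"
      by (rule arc_step_bound) (use m k d(1) in auto)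
    finally show ?thesis by (rule power2_le_imp_le) (use d0 in simp)
  qed
  define b1 where "b1 = t0 - 3 * pi / (2 * \<kappa>)"
  have b1: "b1 < t0" unfolding b1_def using k by simp
  define S1 where "S1 = stall_length d (disp C b1 e) (cis (C p))"
  have S1: "0 \<le> S1" unfolding S1_def using stall_length(1)[OF bound, of b1 "cis (C p)"] b1 by simp
  have S0: "0 \<le> S" unfolding S using stall_length(1)[OF D, of "cis (B p)"] by simp
  have "\<exists>w1. cis w1 * (disp C b1 e + of_real S1 * cis (C p)) = cx (y - x) \<and>
    (window x w0 C t0 e p S p 0 p 0, window x w1 C b1 e p S1 p 0 p 0) \<in> constrained_homotopic \<kappa> x y"
  proof (rule retract_homotopic[OF C d0 d(2)])
    show "norm (disp C ((1 - \<tau>) * t0 + \<tau> * b1) e) \<le> d" if "\<tau> \<in> {0..1}" for \<tau>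
    proof (rule bound)
      have "\<tau> * b1 \<le> \<tau> * t0" using b1 that by (intro mult_left_mono) auto
      then show "(1 - \<tau>) * t0 + \<tau> * b1 \<le> t0" by (simp add: algebra_simps)
    qed
  qed (use p b1 S S1_def dC CB w0 in auto)
  then obtain w1 where w1: "cis w1 * (disp C b1 e + of_real S1 * cis (C p)) = cx (y - x)"
    and h: "(window x w0 C t0 e p S p 0 p 0, window x w1 C b1 e p S1 p 0 p 0) \<in> constrained_homotopic \<kappa> x y"
    by blast
  have e0: "window x w0 C t0 e p S p 0 p 0 = window x w0 B t0 e p S p 0 p 0"
    unfolding window_def
  proof (rule angle_curve_cong)
    show "continuous_on UNIV (\<lambda>u. w0 + stalled C p S p 0 p 0 (u + t0))"
      by (rule angular_continuous[OF angular_shift[OF angular_stalled[OF C S0]]]) simp_all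
    show "continuous_on UNIV (\<lambda>u. w0 + stalled B p S p 0 p 0 (u + t0))"
      by (rule angular_continuous[OF angular_shift[OF angular_stalled[OF B S0]]]) simp_all
    fix u assume "u \<in> {0..e - t0 + S + 0 + 0}"
    then have "t0 \<le> stall p S (u + t0)" using p unfolding stall_def by auto
    then show "cis (w0 + stalled C p S p 0 p 0 (u + t0)) = cis (w0 + stalled B p S p 0 p 0 (u + t0))"
      unfolding stalled_def by (simp add: CB)
  qed
  define g where "g u = w1 + stalled C p S1 p 0 p 0 (u + b1)" for u
  define L where "L = e - b1 + S1 + 0 + 0"
  have L: "t0 - b1 \<le> L" unfolding L_def using p S1 by simp
  have "angular \<kappa> g" unfolding g_def by (rule angular_shift[OF angular_stalled[OF C S1]]) auto
  moreover have "0 < L" using L b1 by simp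
  moreover have "disp g 0 L = cx (y - x)"
    unfolding g_def L_def
    using disp_window[OF angular_continuous[OF C] S1, of 0 0 b1 p p p e w1] p b1 w1 by simp
  \<comment> \<open>The stall at \<open>p\<close> comes after the arc, so the arc enters
    \<open>g\<close> unchanged and contributes the range \<open>3 * pi / 2\<close>.\<close>
  moreover have "wide g L"
  proof -
    have g0: "g 0 = w1 + B t0 + \<sigma> * \<kappa> * (b1 - t0)"
      using b1 p S1 unfolding g_def stalled_def by (simp add: stall_below C_def)
    have g1: "g (t0 - b1) = w1 + B t0"
      using p S1 unfolding g_def stalled_def by (simp add: stall_below CB)
    have "\<kappa> * (b1 - t0) = - (3 * pi / 2)" unfolding b1_def using k by simp
    then have "\<sigma> * \<kappa> * (b1 - t0) = - \<sigma> * (3 * pi / 2)" by (simp add: mult.assoc)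
    then have "\<bar>g 0 - g (t0 - b1)\<bar> = 3 * pi / 2" using sm(4) unfolding g0 g1 by auto
    then have "pi < \<bar>g 0 - g (t0 - b1)\<bar>" using pi_gt_zero by linarith
    moreover have "0 \<in> {0..L}" "t0 - b1 \<in> {0..L}" using L b1 by auto
    ultimately show ?thesis unfolding wide_def by (smt (verit, ccfv_threshold))
  qed
  moreover have "window x w1 C b1 e p S1 p 0 p 0 = angle_curve x L g"
    unfolding window_def g_def L_def ..
  ultimately show ?thesis using h unfolding e0 by metis
qed

lemma homotopic_trans:
  "(a, b) \<in> constrained_homotopic \<kappa> x y \<Longrightarrow> (b, c) \<in> constrained_homotopic \<kappa> x y \<Longrightarrow> (a, c) \<in> constrained_homotopic \<kappa> x y"
  using equivE[OF equiv_constrained_homotopic[of \<kappa> x y]] by (metis transD)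

text \<open>The integral of \<open>w \<bullet> cis (f t)\<close> over the curve is
  \<open>w \<bullet> w\<close>, which is positive. Such a \<open>p\<close> is a place where a stall
  can start with length 0.\<close>

lemma inner_disp_nonneg_somewhere:
  assumes f: "angular \<kappa> f" and L: "0 < L" and v: "disp f 0 L \<noteq> 0"
  shows "\<exists>p\<in>{0..L}. 0 \<le> disp f 0 L \<bullet> cis (f p)"
proof (rule ccontr)
  define w where "w = disp f 0 L"
  assume "\<not> ?thesis"
  then have neg: "w \<bullet> cis (f p) \<le> 0" if "p \<in> {0..L}" for p using that unfolding w_def by (meson linear)
  have "((\<lambda>t. w \<bullet> cis (f t)) has_integral w \<bullet> w) {0..L}"
    using has_integral_linear[OF has_integral_disp[OF angular_continuous[OF f], of 0 L] bounded_linear_inner_right[of w]] L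
    unfolding w_def by (simp add: o_def)
  moreover have "((\<lambda>t. 0) has_integral (0::real)) {0..L}" by simp
  ultimately have "w \<bullet> w \<le> 0" by (rule has_integral_le) (rule neg)
  then show False using v inner_gt_zero_iff[of w] unfolding w_def by (meson not_le)
qed

lemma first_zero:
  fixes a :: "real \<Rightarrow> real"
  assumes c: "continuous_on {0..L} a" and L: "0 \<le> L" "0 \<le> a 0" "a L = 0"
  obtains t where "0 \<le> t" "t \<le> L" "a t = 0" "\<And>s. 0 \<le> s \<Longrightarrow> s \<le> t \<Longrightarrow> 0 \<le> a s"
proof -
  define Z where "Z = {t \<in> {0..L}. a t = 0}"
  have "closed Z"
    using continuous_closed_preimage[OF c closed_atLeastAtMost closed_singleton[of 0]]
    unfolding Z_def by (simp add: vimage_def Int_def)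
  moreover have "bounded Z" by (rule bounded_subset[OF bounded_closed_interval[of 0 L]]) (auto simp: Z_def)
  ultimately have "compact Z" using compact_eq_bounded_closed by blast
  moreover have "Z \<noteq> {}" using L unfolding Z_def by force
  ultimately obtain t where t: "t \<in> Z" "\<And>s. s \<in> Z \<Longrightarrow> t \<le> s"
    using compact_attains_inf[of Z] by blast
  have "0 \<le> a s" if s: "0 \<le> s" "s \<le> t" for s
  proof (rule ccontr)
    assume n: "\<not> 0 \<le> a s"
    have "continuous_on {0..s} a" using continuous_on_subset[OF c] s t(1) unfolding Z_def by auto
    then obtain u where u: "0 \<le> u" "u \<le> s" "a u = 0"
      using IVT2'[of a s 0 0] n L(2) s(1) by auto
    then have "u \<in> Z" using s t(1) unfolding Z_def by auto
    then have "u = s" using t(2) u s by force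
    then show False using u n by simp
  qed
  then show ?thesis using that[of t] t(1) unfolding Z_def by auto
qed

text \<open>If the initial tangent has a nonnegative component along the displacement, the curve is
  consumed from the start until this component first vanishes; before that moment the displacement
  only shrinks. If the component is negative, a straight segment is prepended instead until it
  vanishes.\<close>

lemma far_homotopic_wide:
  assumes f: "angular \<kappa> f" and k: "0 < \<kappa>" and L: "0 < L" and v: "disp f 0 L = cx (y - x)"
    and far: "2 / \<kappa> \<le> norm (y - x)"
  shows "\<exists>g L'. angular \<kappa> g \<and> 0 < L' \<and> disp g 0 L' = cx (y - x) \<and> wide g L' \<and>
    (angle_curve x L f, angle_curve x L' g) \<in> constrained_homotopic \<kappa> x y"
proof -
  define d where "d = norm (y - x)"
  have d: "2 / \<kappa> \<le> d" "norm (y - x) = d" "0 < d"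
    using far k unfolding d_def by (auto intro: less_le_trans[of 0 "2 / \<kappa>"])
  have cf: "continuous_on A f" for A by (rule angular_continuous[OF f])
  define a where "a t = disp f t L \<bullet> cis (f t)" for t
  have nv: "norm (disp f 0 L) = d" unfolding v using d by simp
  have ew: "window x 0 f 0 L p 0 p 0 p 0 = angle_curve x L f" for p
    by (simp add: window_def stalled_def)
  show ?thesis
  proof (cases "0 \<le> a 0")
    case True
    have "continuous_on {0..L} a"
      unfolding a_def by (intro continuous_intros continuous_on_disp[OF f] cf)
    moreover have "a L = 0" unfolding a_def by simp
    ultimately obtain t where t: "0 \<le> t" "t \<le> L" "a t = 0" and pos: "\<And>s. 0 \<le> s \<Longrightarrow> s \<le> t \<Longrightarrow> 0 \<le> a s"
      using first_zero[of L a] L True by (metis less_imp_le)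
    have mono: "norm (disp f s L) \<le> d" if "0 \<le> s" "s \<le> t" for s
      using norm_disp_antimono[OF cf that(1), of L] pos that unfolding nv a_def by simp
    define S where "S = stall_length d (disp f t L) (cis (f t))"
    have S0: "0 = stall_length d (disp f 0 L) (cis (f 0))"
      using stall_length_eq_0[OF nv] True unfolding a_def by simp
    have "\<exists>w1. cis w1 * (disp f t L + of_real S * cis (f t)) = cx (y - x) \<and>
      (window x 0 f 0 L 0 0 0 0 0 0, window x w1 f t L t S t 0 t 0) \<in> constrained_homotopic \<kappa> x y"
    proof (rule retract_homotopic[OF f d(3,2) _ _ _ _ _ S0 S_def])
      show "norm (disp f ((1 - \<tau>) * 0 + \<tau> * t) L) \<le> d" if "\<tau> \<in> {0..1}" for \<tau>
        using mono[of "\<tau> * t"] that t by (simp add: mult_left_le_one_le)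
    qed (use t L v in auto)
    then obtain w1 where w1: "cis w1 * (disp f t L + of_real S * cis (f t)) = cx (y - x)"
      and h: "(angle_curve x L f, window x w1 f t L t S t 0 t 0) \<in> constrained_homotopic \<kappa> x y"
      unfolding ew by blast
    have "\<exists>g L'. angular \<kappa> g \<and> 0 < L' \<and> disp g 0 L' = cx (y - x) \<and> wide g L' \<and>
      (window x w1 f t L t S t 0 t 0, angle_curve x L' g) \<in> constrained_homotopic \<kappa> x y"
      by (rule prepend_arc_homotopic_wide[OF f k d(1,2) order_refl t(2) mono[OF t(1) order_refl] t(3)[unfolded a_def] S_def w1])
    then show ?thesis using homotopic_trans[OF h] by blast
  next
    case False
    \<comment> \<open>A constant angle on the negative axis prepends a straight segment. For the
      start \<open>b \<le> 0\<close> the component along the initial tangent is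
      \<open>a 0 - b\<close>, which vanishes at \<open>b = a 0\<close>.\<close>
    define B where "B t = (if t \<le> 0 then f 0 else f t)" for t
    have "angular \<kappa> (\<lambda>t. f 0)" using angular_affine[of 0 \<kappa> "f 0"] k by simp
    then have B: "angular \<kappa> B" unfolding B_def using f by (rule angular_glue) simp
    have cB: "continuous_on A B" for A by (rule angular_continuous[OF B])
    have Bf: "B t = f t" if "0 \<le> t" for t using that by (cases "t = 0") (auto simp: B_def)
    have dB0: "disp B 0 L = cx (y - x)"
      using disp_cong[OF cB cf, of 0 L] L Bf v by simp
    have dB: "disp B b L = cx (y - x) - of_real b * cis (f 0)" if "b \<le> 0" for b
      using disp_const[OF cB that, of "f 0"] disp_add[of B b 0 L] dB0 by (simp add: B_def algebra_simps)
    have a0: "a 0 = cx (y - x) \<bullet> cis (f 0)" unfolding a_def v ..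
    have nB: "norm (disp B b L) \<le> d" if b: "a 0 \<le> b" "b \<le> 0" for b
    proof -
      have "(norm (disp B b L))\<^sup>2 = (norm (cx (y - x)))\<^sup>2 - 2 * b * a 0 + b\<^sup>2 * (norm (cis (f 0)))\<^sup>2"
      proof -
        have "(norm (w - of_real b * z))\<^sup>2 = (norm w)\<^sup>2 - 2 * b * (w \<bullet> z) + b\<^sup>2 * (norm z)\<^sup>2" for w z :: complex
          unfolding cmod_power2 inner_complex_def by (simp add: power2_eq_square algebra_simps)
        then show ?thesis unfolding dB[OF b(2)] a0 .
      qed
      also have "\<dots> = d\<^sup>2 + b * (b - 2 * a 0)" using d(2) by (simp add: power2_eq_square algebra_simps)
      also have "\<dots> \<le> d\<^sup>2" using mult_nonpos_nonneg[of b "b - 2 * a 0"] b False by simp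
      finally show ?thesis by (rule power2_le_imp_le) (use d(3) in simp)
    qed
    \<comment> \<open>The initial direction has a negative component along the displacement, so the
      stall goes elsewhere in order to start with length 0.\<close>
    obtain p where p: "p \<in> {0..L}" "0 \<le> cx (y - x) \<bullet> cis (f p)"
    proof -
      have "disp f 0 L \<noteq> 0" using nv d(3) by auto
      then show ?thesis using inner_disp_nonneg_somewhere[OF f L] that unfolding v by blast
    qed
    define S where "S = stall_length d (disp B (a 0) L) (cis (B p))"
    have S0: "0 = stall_length d (disp B 0 L) (cis (B p))"
      using stall_length_eq_0[of "disp B 0 L" d "cis (B p)"] p Bf[of p] d(2) unfolding dB0 by simp
    have "\<exists>w1. cis w1 * (disp B (a 0) L + of_real S * cis (B p)) = cx (y - x) \<and>
      (window x 0 B 0 L p 0 p 0 p 0, window x w1 B (a 0) L p S p 0 p 0) \<in> constrained_homotopic \<kappa> x y"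
    proof (rule retract_homotopic[OF B d(3,2) _ _ _ _ _ S0 S_def])
      show "norm (disp B ((1 - \<tau>) * 0 + \<tau> * a 0) L) \<le> d" if "\<tau> \<in> {0..1}" for \<tau>
      proof -
        have "1 * a 0 \<le> \<tau> * a 0" by (rule mult_right_mono_neg) (use that False in auto)
        moreover have "\<tau> * a 0 \<le> 0" by (rule mult_nonneg_nonpos) (use that False in auto)
        ultimately show ?thesis using nB[of "\<tau> * a 0"] by simp
      qed
    qed (use p L False dB0 in auto)
    then obtain w1 where w1: "cis w1 * (disp B (a 0) L + of_real S * cis (B p)) = cx (y - x)"
      and h: "(window x 0 B 0 L p 0 p 0 p 0, window x w1 B (a 0) L p S p 0 p 0) \<in> constrained_homotopic \<kappa> x y"
      by blast
    have "window x 0 B 0 L p 0 p 0 p 0 = angle_curve x L f"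
      using angle_curve_cong[OF cB cf, of L x] Bf by (simp add: window_def stalled_def)
    moreover have "\<exists>g L'. angular \<kappa> g \<and> 0 < L' \<and> disp g 0 L' = cx (y - x) \<and> wide g L' \<and>
      (window x w1 B (a 0) L p S p 0 p 0, angle_curve x L' g) \<in> constrained_homotopic \<kappa> x y"
    proof (rule prepend_arc_homotopic_wide[OF B k d(1,2) _ _ nB _ S_def w1])
      have "B (a 0) = f 0" using False by (simp add: B_def)
      moreover have "cis (f 0) \<bullet> cis (f 0) = 1" by (simp add: dot_square_norm)
      ultimately show "disp B (a 0) L \<bullet> cis (B (a 0)) = 0"
        using dB[of "a 0"] False a0
        by (simp add: inner_diff_left scaleR_conv_of_real[symmetric])
    qed (use p False in auto)
    ultimately show ?thesis using homotopic_trans[of "angle_curve x L f"] h by metis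
  qed
qed

section \<open>Counting the classes\<close>

lemma quotient_eqI:
  assumes "\<And>a. a \<in> A \<Longrightarrow> r `` {a} \<in> K" "\<And>X. X \<in> K \<Longrightarrow> X \<in> A // r"
  shows "A // r = K"
proof
  show "A // r \<subseteq> K" using assms(1) by (auto elim!: quotientE)
  show "K \<subseteq> A // r" using assms(2) by blast
qed

theorem theorem5p1:
  fixes \<kappa> r d :: real and x y :: "real^2"
  assumes "\<kappa> > 0" and "r = 1 / \<kappa>" and "d = norm (x - y)"
  shows "card (homotopy_classes \<kappa> x y) = (if d = 0 then 1 else if d < 2 * r then 2 else 1)"
proof -
  let ?M = "constrained_curves \<kappa> x y" and ?R = "constrained_homotopic \<kappa> x y"
  note k = assms(1)
  have d: "norm (y - x) = d" using assms(3) by (simp add: norm_minus_commute)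
  have r2: "2 * r = 2 / \<kappa>" using assms(2) by simp
  note eqv = equiv_constrained_homotopic[of \<kappa> x y]
  obtain c0 where c0: "c0 \<in> ?M" "2 * pi / \<kappa> \<le> fst c0"
    and wide: "\<And>f L. angular \<kappa> f \<Longrightarrow> 0 < L \<Longrightarrow> disp f 0 L = cx (y - x) \<Longrightarrow> wide f L \<Longrightarrow> (angle_curve x L f, c0) \<in> ?R"
    using wide_homotopic_standard[OF k, of x y] by blast
  have repr: "\<exists>f. angular \<kappa> f \<and> 0 < fst c \<and> c = angle_curve x (fst c) f \<and> disp f 0 (fst c) = cx (y - x)" if "c \<in> ?M" for c
    by (rule constrained_curve_as_angle_curve[OF _ that]) (use k in simp)
  have one: "card (homotopy_classes \<kappa> x y) = 1" if all: "\<And>c. c \<in> ?M \<Longrightarrow> (c, c0) \<in> ?R"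
  proof -
    have "?R `` {c} = ?R `` {c0}" if "c \<in> ?M" for c
      by (rule equiv_class_eq[OF eqv all[OF that]])
    then have "homotopy_classes \<kappa> x y = {?R `` {c0}}"
      unfolding homotopy_classes_def by (intro quotient_eqI) (use quotientI[OF c0(1)] in blast)+
    then show ?thesis by simp
  qed
  have long: "(c, c0) \<in> ?R" if c: "c \<in> ?M" and l: "pi / \<kappa> \<le> fst c" and dr: "d < 2 * r" for c
  proof -
    obtain f where f: "angular \<kappa> f" "0 < fst c" "c = angle_curve x (fst c) f" "disp f 0 (fst c) = cx (y - x)"
      using repr[OF c] by blast
    have "wide f (fst c)"
      using narrow_disp_ge[OF f(1) k l] f(4) dr d r2 by (metis norm_cx not_less)
    then show ?thesis using wide[OF f(1,2,4)] f(3) by simp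
  qed
  consider "d = 0" | "0 < d" "d < 2 * r" | "0 < d" "2 * r \<le> d"
    using assms(3) norm_ge_zero[of "x - y"] by linarith
  then show ?thesis
  proof cases
    case 1
    have "(c, c0) \<in> ?R" if c: "c \<in> ?M" for c
    proof (rule long[OF c])
      obtain f where f: "angular \<kappa> f" "0 < fst c" "c = angle_curve x (fst c) f" "disp f 0 (fst c) = cx (y - x)"
        using repr[OF c] by blast
      have "disp f 0 (fst c) = 0" using f(4) 1 d by (metis norm_cx norm_eq_zero)
      \<comment> \<open>A shorter closed curve would have a positive displacement along its initial
        tangent.\<close>
      show "pi / \<kappa> \<le> fst c"
      proof (rule ccontr)
        assume "\<not> ?thesis"
        then have l: "\<kappa> * fst c < pi" using k by (simp add: field_simps)
        then have "0 < sin (\<kappa> * fst c)" using k f(2) by (intro sin_gt_zero) auto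
        then have "0 < sin (\<kappa> * fst c) / \<kappa>" using k by simp
        then show False
          using short_disp_inner_ge[OF f(1) k, of 0 "fst c"] f(2) l \<open>disp f 0 (fst c) = 0\<close> by simp
      qed
      show "d < 2 * r" using 1 r2 k by simp
    qed
    then show ?thesis using one 1 by simp
  next
    case 2
    have xy: "x \<noteq> y" using 2 assms(3) by auto
    define c1 where "c1 = angle_curve x d (\<lambda>_. Arg (cx (y - x)))"
    have c1: "c1 \<in> ?M"
      unfolding c1_def
    proof (rule angle_curve_in_constrained_curves)
      show "angular \<kappa> (\<lambda>_. Arg (cx (y - x)))" using angular_affine[of 0 \<kappa>] k by simp
      have "cx (y - x) \<noteq> 0" using 2 d by (metis norm_cx norm_zero less_irrefl)
      then show "disp (\<lambda>_. Arg (cx (y - x))) 0 d = cx (y - x)"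
        using disp_const[of "\<lambda>_. Arg (cx (y - x))" 0 d "Arg (cx (y - x))"] 2 d
        by (simp add: cis_Arg sgn_div_norm scaleR_conv_of_real)
    qed (use 2 in simp)
    have short: "(c, c1) \<in> ?R" if c: "c \<in> ?M" and l: "fst c < pi / \<kappa>" for c
    proof -
      obtain f where f: "angular \<kappa> f" "0 < fst c" "c = angle_curve x (fst c) f" "disp f 0 (fst c) = cx (y - x)"
        using repr[OF c] by blast
      have "\<kappa> * fst c < pi" using l k by (simp add: field_simps)
      then show ?thesis
        using short_homotopic_segment[OF f(1) k f(2) _ f(4) xy] f(3) d unfolding c1_def by simp
    qed
    have no: "fst c \<noteq> pi / \<kappa>" if c: "c \<in> ?M" for c
    proof
      assume l: "fst c = pi / \<kappa>"
      obtain f where f: "angular \<kappa> f" "0 < fst c" "c = angle_curve x (fst c) f" "disp f 0 (fst c) = cx (y - x)"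
        using repr[OF c] by blast
      \<comment> \<open>A curve of length \<open>pi / \<kappa>\<close> turns by at most
        \<open>pi\<close> in total.\<close>
      have "\<not> wide f (fst c)"
      proof
        assume "wide f (fst c)"
        then obtain s t where st: "s \<in> {0..fst c}" "t \<in> {0..fst c}" "pi < f t - f s" unfolding wide_def by blast
        have "f t - f s \<le> \<kappa> * \<bar>t - s\<bar>" using angularD[OF f(1), of t s] by simp
        also have "\<dots> \<le> \<kappa> * fst c" by (rule mult_left_mono) (use st k in auto)
        also have "\<dots> = pi" using l k by simp
        finally show False using st(3) by simp
      qed
      then show False
        using narrow_disp_ge[OF f(1) k, of "fst c"] l f(4) 2 d r2 by simp
    qed
    have "fst c1 \<le> pi / \<kappa>"
    proof -
      have "2 / \<kappa> \<le> pi / \<kappa>" using k pi_ge_two by (intro divide_right_mono) auto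
      then show ?thesis using 2 r2 unfolding c1_def by simp
    qed
    moreover have "pi / \<kappa> \<le> fst c0"
    proof -
      have "pi / \<kappa> \<le> 2 * pi / \<kappa>" using k pi_gt_zero by (intro divide_right_mono) auto
      then show ?thesis using c0(2) by linarith
    qed
    \<comment> \<open>The segment is shorter than \<open>2 / \<kappa>\<close> and the standard wide
      curve has length at least \<open>2 * pi / \<kappa>\<close>, so a homotopy between them would
      have to pass the excluded length \<open>pi / \<kappa>\<close>.\<close>
    ultimately have ne: "(c1, c0) \<notin> ?R"
      using homotopic_length_attained[of c1 c0 \<kappa> x y "pi / \<kappa>"] no by blast
    have "?R `` {c} \<in> {?R `` {c0}, ?R `` {c1}}" if c: "c \<in> ?M" for c
    proof (cases "fst c < pi / \<kappa>")
      case True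
      show ?thesis using equiv_class_eq[OF eqv short[OF c True]] by blast
    next
      case False
      then have "(c, c0) \<in> ?R" using 2 by (intro long[OF c]) auto
      then show ?thesis using equiv_class_eq[OF eqv] by blast
    qed
    then have "homotopy_classes \<kappa> x y = {?R `` {c0}, ?R `` {c1}}"
      unfolding homotopy_classes_def
      by (intro quotient_eqI) (use quotientI[OF c0(1)] quotientI[OF c1] in blast)+
    moreover have "?R `` {c0} \<noteq> ?R `` {c1}"
      using eq_equiv_class[OF _ eqv c0(1), of c1] ne by metis
    ultimately show ?thesis using 2 by simp
  next
    case 3
    have "(c, c0) \<in> ?R" if c: "c \<in> ?M" for c
    proof -
      obtain f where f: "angular \<kappa> f" "0 < fst c" "c = angle_curve x (fst c) f" "disp f 0 (fst c) = cx (y - x)"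
        using repr[OF c] by blast
      obtain g L where g: "angular \<kappa> g" "0 < L" "disp g 0 L = cx (y - x)" "wide g L"
        and h: "(angle_curve x (fst c) f, angle_curve x L g) \<in> ?R"
        using far_homotopic_wide[OF f(1) k f(2,4)] 3 d r2 by auto
      show ?thesis using homotopic_trans[OF h wide[OF g]] f(3) by simp
    qed
    then show ?thesis using one 3 by simp
  qed
qed

end
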